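(* Let $H^2_{\beta}$ be a weighted Hardy space of polynomial growth induced by the weight sequence $w=\{w_k\}_{k=1}^{\infty}$. Then for every $\varphi\in\mathrm{Aut}(\mathbb{D})$ the multiplication operators $M_z$ and $M_{\varphi}$ on $H^2_{\beta}$ are similar, i.e., $M_z$ is weakly homogeneous on $H^2_{\beta}$. In fact, for every $\varphi\in\mathrm{Aut}(\mathbb{D})$ the composition operator $C_{\varphi}:H^2_{\beta}\to H^2_{\beta}$, $C_\varphi(f)=f\circ\varphi$, is an isomorphism (a bounded invertible operator).
   Context: $\mathbb{D}$ is the open unit disk in $\mathbb{C}$; $\mathrm{Aut}(\mathbb{D})$ is the group of analytic bijections of $\mathbb{D}$ onto itself. Let $w=\{w_k\}_{k\ge1}$ be positive numbers with $w_k\to1$; put $\beta_0=1$, $\beta_k=\prod_{j=1}^k w_j$. The weighted Hardy space $H^2_\beta$ induced by $w$ is the Hilbert space of functions $f(z)=\sum_{k\ge0}\widehat f(k)z^k$ analytic on $\mathbb{D}$ with $\|f\|^2=\sum_{k\ge0}|\widehat f(k)|^2\beta_k^2<\infty$. It is of polynomial growth if $\sup_k (k+1)|w_k-1|<\infty$. $M_f$ denotes multiplication by $f$; it is bounded on $H^2_\beta$ for every $f$ analytic on a neighborhood of $\overline{\mathbb{D}}$. Two bounded operators $A,B$ are similar ($A\sim B$) if $XA=BX$ for some bounded invertible $X$. A bounded operator $T$ on a complex separable Hilbert space is weakly homogeneous if its spectrum satisfies $\sigma(T)\subseteq\overline{\mathbb{D}}$ and $T\sim\varphi(T)$ for every $\varphi\in\mathrm{Aut}(\mathbb{D})$;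 here $\varphi(M_z)=M_\varphi$. *)

theory Defs
  imports "HOL-Complex_Analysis.Complex_Analysis"
begin

section \<open>Bounded operators on normed spaces of complex-valued functions\<close>

text \<open>
  The space depends on the weight sequence, so it cannot be a type. A space is given by a
  carrier \<open>V\<close>, a set of complex-valued functions closed under the pointwise operations,
  together with a norm \<open>N\<close>. Operators are total functions whose values outside \<open>V\<close> are
  irrelevant.
\<close>

definition bounded_op ::
    "('x \<Rightarrow> complex) set \<Rightarrow> (('x \<Rightarrow> complex) \<Rightarrow> real) \<Rightarrow> (('x \<Rightarrow> complex) \<Rightarrow> 'x \<Rightarrow> complex) \<Rightarrow> bool"
  where "bounded_op V N T \<longleftrightarrow>
    (\<forall>f\<in>V. T f \<in> V) \<and>
    (\<forall>f\<in>V. \<forall>g\<in>V. T (\<lambda>x. f x + g x) = (\<lambda>x. T f x + T g x)) \<and>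
    (\<forall>c. \<forall>f\<in>V. T (\<lambda>x. c * f x) = (\<lambda>x. c * T f x)) \<and>
    (\<exists>C. \<forall>f\<in>V. N (T f) \<le> C * N f)"

definition invertible_op ::
    "('x \<Rightarrow> complex) set \<Rightarrow> (('x \<Rightarrow> complex) \<Rightarrow> real) \<Rightarrow> (('x \<Rightarrow> complex) \<Rightarrow> 'x \<Rightarrow> complex) \<Rightarrow> bool"
  where "invertible_op V N T \<longleftrightarrow>
    bounded_op V N T \<and> (\<exists>S. bounded_op V N S \<and> (\<forall>f\<in>V. S (T f) = f \<and> T (S f) = f))"

definition similar_ops ::
    "('x \<Rightarrow> complex) set \<Rightarrow> (('x \<Rightarrow> complex) \<Rightarrow> real) \<Rightarrow>
     (('x \<Rightarrow> complex) \<Rightarrow> 'x \<Rightarrow> complex) \<Rightarrow> (('x \<Rightarrow> complex) \<Rightarrow> 'x \<Rightarrow> complex) \<Rightarrow> bool"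
  where "similar_ops V N A B \<longleftrightarrow>
    bounded_op V N A \<and> bounded_op V N B \<and>
    (\<exists>X. invertible_op V N X \<and> (\<forall>f\<in>V. X (A f) = B (X f)))"

definition op_spectrum ::
    "('x \<Rightarrow> complex) set \<Rightarrow> (('x \<Rightarrow> complex) \<Rightarrow> real) \<Rightarrow>
     (('x \<Rightarrow> complex) \<Rightarrow> 'x \<Rightarrow> complex) \<Rightarrow> complex set"
  where "op_spectrum V N T = {c. \<not> invertible_op V N (\<lambda>f x. T f x - c * f x)}"

text \<open>
  \<open>is_fun_calc V N T \<phi> S\<close> expresses \<open>S = \<phi>(T)\<close>, where \<open>\<phi>(T) = (\<Sum>k. a\<^sub>k T\<^sup>k)\<close> in operator norm
  and the \<open>a\<^sub>k\<close> are the Taylor coefficients of \<open>\<phi>\<close> at 0. If \<open>\<phi>\<close> is holomorphic on a disk of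
  radius greater than 1 (such as a disk automorphism) and the spectrum of \<open>T\<close> lies in the closed
  unit disk, this is the value of the holomorphic functional calculus.
\<close>

definition is_fun_calc ::
    "('x \<Rightarrow> complex) set \<Rightarrow> (('x \<Rightarrow> complex) \<Rightarrow> real) \<Rightarrow>
     (('x \<Rightarrow> complex) \<Rightarrow> 'x \<Rightarrow> complex) \<Rightarrow> (complex \<Rightarrow> complex) \<Rightarrow>
     (('x \<Rightarrow> complex) \<Rightarrow> 'x \<Rightarrow> complex) \<Rightarrow> bool"
  where "is_fun_calc V N T \<phi> S \<longleftrightarrow>
    bounded_op V N S \<and>
    (\<forall>e>0. \<forall>\<^sub>F n in sequentially. \<forall>f\<in>V.
      N (\<lambda>x. (\<Sum>k<n. fps_nth (fps_expansion \<phi> 0) k * (T ^^ k) f x) - S f x) \<le> e * N f)"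

definition disk_aut :: "(complex \<Rightarrow> complex) set"
  where "disk_aut = {\<phi>. \<phi> holomorphic_on ball 0 1 \<and> bij_betw \<phi> (ball 0 1) (ball 0 1)}"

definition weakly_homogeneous ::
    "('x \<Rightarrow> complex) set \<Rightarrow> (('x \<Rightarrow> complex) \<Rightarrow> real) \<Rightarrow> (('x \<Rightarrow> complex) \<Rightarrow> 'x \<Rightarrow> complex) \<Rightarrow> bool"
  where "weakly_homogeneous V N T \<longleftrightarrow>
    bounded_op V N T \<and> op_spectrum V N T \<subseteq> cball 0 1 \<and>
    (\<forall>\<phi>\<in>disk_aut. \<exists>S. is_fun_calc V N T \<phi> S \<and> similar_ops V N T S)"

section \<open>Weighted Hardy spaces\<close>

text \<open>Weights are indexed from 1; the value of \<open>w\<close> at 0 plays no role.\<close>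

definition weight_seq :: "(nat \<Rightarrow> real) \<Rightarrow> bool"
  where "weight_seq w \<longleftrightarrow> (\<forall>k\<ge>1. w k > 0) \<and> w \<longlonglongrightarrow> 1"

definition polynomial_growth :: "(nat \<Rightarrow> real) \<Rightarrow> bool"
  where "polynomial_growth w \<longleftrightarrow> bdd_above ((\<lambda>k. real (k + 1) * \<bar>w k - 1\<bar>) ` {1..})"

definition weight_prod :: "(nat \<Rightarrow> real) \<Rightarrow> nat \<Rightarrow> real"
  where "weight_prod w k = (\<Prod>j=1..k. w j)"

text \<open>
  Functions on the open unit disk are represented by their extension by 0, so that equality of
  elements is equality on the disk.
\<close>

definition hardy_space :: "(nat \<Rightarrow> real) \<Rightarrow> (complex \<Rightarrow> complex) set"
  where "hardy_space w =
    {f. f holomorphic_on ball 0 1 \<and> (\<forall>z. z \<notin> ball 0 1 \<longrightarrow> f z = 0) \<and>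
        summable (\<lambda>k. (cmod (fps_nth (fps_expansion f 0) k))\<^sup>2 * (weight_prod w k)\<^sup>2)}"

definition hardy_norm :: "(nat \<Rightarrow> real) \<Rightarrow> (complex \<Rightarrow> complex) \<Rightarrow> real"
  where "hardy_norm w f =
    sqrt (\<Sum>k. (cmod (fps_nth (fps_expansion f 0) k))\<^sup>2 * (weight_prod w k)\<^sup>2)"

definition mult_op :: "(complex \<Rightarrow> complex) \<Rightarrow> (complex \<Rightarrow> complex) \<Rightarrow> complex \<Rightarrow> complex"
  where "mult_op g f = (\<lambda>z. if z \<in> ball 0 1 then g z * f z else 0)"

definition comp_op :: "(complex \<Rightarrow> complex) \<Rightarrow> (complex \<Rightarrow> complex) \<Rightarrow> complex \<Rightarrow> complex"
  where "comp_op \<phi> f = (\<lambda>z. if z \<in> ball 0 1 then f (\<phi> z) else 0)"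

end

theory Submission
  imports Defs "HOL-Real_Asymp.Real_Asymp"
begin

text \<open>
  The automorphisms \<open>\<Phi>\<^sub>s(z) = (z + s) / (1 + s z)\<close> with \<open>s = tanh t\<close> form a flow with generator
  \<open>G = (1 - z\<^sup>2) d/dz\<close>. For \<open>f = \<Sum> a\<^sub>k z\<^sup>k\<close> summation by parts gives
  \<open>Re \<langle>G f, f\<rangle> = \<Sum> Re (a\<^sub>k\<^sub>+\<^sub>1 cnj a\<^sub>k) ((k + 1) \<beta>\<^sub>k\<^sup>2 - k \<beta>\<^sub>k\<^sub>+\<^sub>1\<^sup>2)\<close>, and polynomial growth says that the
  bracket is \<open>O(\<beta>\<^sub>k \<beta>\<^sub>k\<^sub>+\<^sub>1)\<close>. Hence \<open>\<bar>Re \<langle>G f, f\<rangle>\<bar> \<le> C \<parallel>f\<parallel>\<^sup>2\<close>, and Gronwall's inequality bounds the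
  composition operators \<open>C\<^sub>\<Phi>\<close>, first on polynomials and then, coefficient by coefficient, on the
  whole space. Every disk automorphism is a \<open>\<Phi>\<^sub>s\<close> with \<open>0 \<le> s < 1\<close> between two rotations, which act
  isometrically. The rest is formal: \<open>C\<^sub>\<phi> M\<^sub>z = M\<^sub>\<phi> C\<^sub>\<phi>\<close> gives boundedness of \<open>M\<^sub>\<phi>\<close> and similarity, and
  \<open>1 / (1 - b z)\<close> for \<open>\<bar>b\<bar> < 1\<close> is an affine function of an automorphism, which yields the
  resolvent of \<open>M\<^sub>z\<close> and controls the Taylor remainders of \<open>\<phi>\<close>.
\<close>

section \<open>The hyperbolic flow on power series\<close>

text \<open>The Taylor series of (z + s) / (1 + s z) at 0. The field stays open because the flow is
  differentiated and estimated over the reals, while composition takes place over the complex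
  numbers.\<close>

definition disk_fps :: "'a::real_normed_field \<Rightarrow> 'a fps"
  where "disk_fps s = Abs_fps (\<lambda>k. case k of 0 \<Rightarrow> s | Suc j \<Rightarrow> (1 - s\<^sup>2) * (- s) ^ j)"

lemma disk_fps_nth [simp]:
  "fps_nth (disk_fps s) 0 = s"
  "fps_nth (disk_fps s) (Suc j) = (1 - s\<^sup>2) * (- s) ^ j"
  by (simp_all add: disk_fps_def)

lemma disk_fps_0: "disk_fps 0 = fps_X"
  by (rule fps_ext) (auto simp: disk_fps_def fps_X_def split: nat.split)

text \<open>A real parameter makes the matrix of the composition operator in the monomial basis
  real, so the real energy estimate carries over to complex coefficients.\<close>

lemma disk_fps_of_real_power_nth:
  "fps_nth (disk_fps (of_real s) ^ n) k = (of_real (fps_nth (disk_fps s ^ n) k) :: 'a::real_normed_field)"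
proof (induction n arbitrary: k)
  case 0
  then show ?case by simp
next
  case (Suc n)
  have "fps_nth (disk_fps (of_real s)) i = (of_real (fps_nth (disk_fps s) i) :: 'a)" for i
    by (cases i) simp_all
  then show ?case
    using Suc by (simp add: fps_mult_nth)
qed

lemma disk_fps_mult: "disk_fps s * (1 + fps_const s * fps_X) = fps_X + fps_const s"
proof (rule fps_ext)
  fix k
  show "fps_nth (disk_fps s * (1 + fps_const s * fps_X)) k = fps_nth (fps_X + fps_const s) k"
  proof (cases k)
    case 0
    then show ?thesis by (simp add: distrib_left)
  next
    case (Suc j)
    have *: "fps_nth (disk_fps s * (1 + fps_const s * fps_X)) k
        = fps_nth (disk_fps s) k + s * fps_nth (disk_fps s) j"
    proof -
      have "disk_fps s * (1 + fps_const s * fps_X)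
          = disk_fps s + fps_const s * (disk_fps s * fps_X)"
        by (simp only: distrib_left mult_1_right mult.left_commute)
      then show ?thesis
        by (simp only: fps_add_nth fps_mult_left_const_nth fps_X_mult_right_nth Suc) simp
    qed
    then show ?thesis
    proof (cases j)
      case 0
      then show ?thesis
        using * Suc by (simp add: power2_eq_square)
    next
      case (Suc i)
      then show ?thesis
        using * \<open>k = Suc j\<close> by (simp add: fps_X_def)
    qed
  qed
qed

lemma has_fps_expansion_disk_fps_power:
  "(\<lambda>z. ((z + s) / (1 + s * z)) ^ n) has_fps_expansion (disk_fps s ^ n :: complex fps)"
proof -
  let ?D = "1 + fps_const s * fps_X"
  have inv: "?D * inverse ?D = 1"
    by (rule inverse_mult_eq_1') simp
  have "disk_fps s * (?D * inverse ?D) = (fps_X + fps_const s) * inverse ?D"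
    by (simp only: mult.assoc[symmetric] disk_fps_mult)
  then have eq: "disk_fps s = (fps_X + fps_const s) * inverse ?D"
    by (simp only: inv mult_1_right)
  have "(\<lambda>z. (z + s) * inverse (1 + s * z)) has_fps_expansion disk_fps s"
    by (subst eq, intro fps_expansion_intros) simp
  then have 1: "(\<lambda>z. (z + s) / (1 + s * z)) has_fps_expansion disk_fps s"
    by (simp add: divide_inverse)
  show ?thesis
    using has_fps_expansion_power[OF 1] .
qed

text \<open>The generator of the flow \<open>t \<mapsto> (z + tanh t) / (1 + z tanh t)\<close> of disk automorphisms.\<close>

definition flow_gen :: "'a::comm_ring_1 fps \<Rightarrow> 'a fps"
  where "flow_gen F = (1 - fps_X\<^sup>2) * fps_deriv F"

text \<open>Truncated subtraction does no harm: for \<open>k = 0\<close> and \<open>k = 1\<close>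
  the factor \<open>of_nat (k - 1)\<close> vanishes.\<close>

lemma flow_gen_nth:
  "fps_nth (flow_gen F) k = of_nat (k + 1) * fps_nth F (k + 1) - of_nat (k - 1) * fps_nth F (k - 1)"
proof -
  have "fps_nth (flow_gen F) k
      = fps_nth (fps_deriv F) k - (if k < 2 then 0 else fps_nth (fps_deriv F) (k - 2))"
    by (simp add: flow_gen_def left_diff_distrib fps_X_power_mult_nth)
  also have "\<dots> = of_nat (k + 1) * fps_nth F (k + 1) - of_nat (k - 1) * fps_nth F (k - 1)"
  proof (cases "k < 2")
    case True
    then have "k = 0 \<or> k = 1" by auto
    then show ?thesis by auto
  next
    case False
    then obtain j where "k = Suc (Suc j)"
      by (metis add_2_eq_Suc le_Suc_ex not_less)
    then show ?thesis by simp
  qed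
  finally show ?thesis .
qed

lemma flow_gen_mult: "flow_gen (F * G) = F * flow_gen G + flow_gen F * G"
  by (simp add: flow_gen_def algebra_simps)

text \<open>For \<open>s = tanh t\<close> the derivative of \<open>s\<close> in \<open>t\<close> is
  \<open>1 - s\<^sup>2\<close>, so differentiating the flow in \<open>s\<close> instead of
  \<open>t\<close> divides the generator by this factor.\<close>

lemma disk_fps_nth_deriv:
  fixes s :: real
  assumes "\<bar>s\<bar> < 1"
  shows "((\<lambda>s. fps_nth (disk_fps s) k) has_real_derivative
           fps_nth (flow_gen (disk_fps s)) k / (1 - s\<^sup>2)) (at s)"
proof -
  have s: "1 - s\<^sup>2 \<noteq> 0"
    using assms abs_square_less_1[of s] by linarith
  consider "k = 0" | "k = 1" | j where "k = Suc (Suc j)"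
    by (metis One_nat_def not0_implies_Suc)
  then show ?thesis
  proof cases
    case 1
    then show ?thesis using s by (simp add: flow_gen_nth)
  next
    case 2
    have "((\<lambda>s. 1 - s\<^sup>2) has_real_derivative - 2 * s) (at s)"
      by (auto intro!: derivative_eq_intros)
    moreover have "fps_nth (flow_gen (disk_fps s)) k = (1 - s\<^sup>2) * (- 2 * s)"
      using 2 by (simp add: flow_gen_nth)
    ultimately show ?thesis
      using 2 s by simp
  next
    case 3
    have "((\<lambda>s. (1 - s\<^sup>2) * (- s) ^ Suc j) has_real_derivative
          (- 2 * s) * (- s) ^ Suc j - (1 - s\<^sup>2) * (real (Suc j) * (- s) ^ j)) (at s)"
      by (auto intro!: derivative_eq_intros simp del: power_Suc)
    moreover have "fps_nth (flow_gen (disk_fps s)) k =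
        (1 - s\<^sup>2) * ((- 2 * s) * (- s) ^ Suc j - (1 - s\<^sup>2) * (real (Suc j) * (- s) ^ j))"
    proof -
      define y where "y = (- s) ^ j"
      have "(3 + real j) * ((1 - s\<^sup>2) * (- s * (- s * y))) - (1 + real j) * ((1 - s\<^sup>2) * y)
          = (1 - s\<^sup>2) * ((- 2 * s) * (- s * y) - (1 - s\<^sup>2) * (real (Suc j) * y))"
        by (simp add: power2_eq_square algebra_simps)
      then show ?thesis
        using 3 by (simp add: flow_gen_nth y_def)
    qed
    ultimately show ?thesis
      using 3 s by simp
  qed
qed

text \<open>Differentiation in \<open>s\<close> and \<open>flow_gen\<close> both obey the product
  rule, so the identity passes from the series to its powers by induction.\<close>

lemma disk_fps_power_nth_deriv:
  fixes s :: real
  assumes "\<bar>s\<bar> < 1"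
  shows "((\<lambda>s. fps_nth (disk_fps s ^ n) k) has_real_derivative
           fps_nth (flow_gen (disk_fps s ^ n)) k / (1 - s\<^sup>2)) (at s)"
proof (induction n arbitrary: k)
  case 0
  then show ?case by (simp add: flow_gen_def)
next
  case (Suc n)
  have "((\<lambda>s. \<Sum>i=0..k. fps_nth (disk_fps s) i * fps_nth (disk_fps s ^ n) (k - i)) has_real_derivative
       (\<Sum>i=0..k. fps_nth (disk_fps s) i * (fps_nth (flow_gen (disk_fps s ^ n)) (k - i) / (1 - s\<^sup>2))
         + fps_nth (flow_gen (disk_fps s)) i / (1 - s\<^sup>2) * fps_nth (disk_fps s ^ n) (k - i))) (at s)"
    by (intro DERIV_sum DERIV_mult' disk_fps_nth_deriv assms Suc)
  also have "(\<lambda>s. \<Sum>i=0..k. fps_nth (disk_fps s) i * fps_nth (disk_fps s ^ n) (k - i))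
      = (\<lambda>s. fps_nth (disk_fps s ^ Suc n) k)"
    by (simp add: fps_mult_nth)
  also have "(\<Sum>i=0..k. fps_nth (disk_fps s) i * (fps_nth (flow_gen (disk_fps s ^ n)) (k - i) / (1 - s\<^sup>2))
         + fps_nth (flow_gen (disk_fps s)) i / (1 - s\<^sup>2) * fps_nth (disk_fps s ^ n) (k - i))
      = fps_nth (flow_gen (disk_fps s ^ Suc n)) k / (1 - s\<^sup>2)"
    by (simp add: flow_gen_mult fps_mult_nth sum.distrib sum_divide_distrib add_divide_distrib)
  finally show ?case .
qed

text \<open>The base series has \<open>i\<close>-th coefficient at most \<open>a ^ i / a\<close>,
  and each convolution has at most \<open>k + 1\<close> terms. The bound is crude but uniform in
  \<open>s\<close>; its geometric decay in \<open>k\<close> for fixed \<open>n\<close> is what makes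
  the boundary terms of the energy estimate vanish.\<close>

lemma disk_fps_power_nth_bound:
  fixes s a :: real
  assumes "0 \<le> s" "s \<le> a" "0 < a" "a < 1"
  shows "\<bar>fps_nth (disk_fps s ^ n) k\<bar> \<le> real (k + 1) ^ n * a ^ k / a ^ n"
proof (induction n arbitrary: k)
  case 0
  have "0 \<le> a ^ k" using assms by simp
  then show ?case by simp
next
  case (Suc n)
  have base: "\<bar>fps_nth (disk_fps s) i\<bar> \<le> a ^ i / a" for i
  proof (cases i)
    case 0
    have "a * s \<le> 1 * 1"
      using assms by (intro mult_mono) auto
    then show ?thesis
      using 0 assms by (simp add: field_simps)
  next
    case (Suc j)
    have "s\<^sup>2 \<le> 1" using assms by (simp add: power_le_one)
    then have "\<bar>1 - s\<^sup>2\<bar> * s ^ j \<le> 1 * a ^ j"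
      using assms by (intro mult_mono power_mono) auto
    then show ?thesis
      using assms by (simp add: Suc abs_mult power_abs)
  qed
  have "\<bar>fps_nth (disk_fps s ^ Suc n) k\<bar>
      \<le> (\<Sum>i=0..k. \<bar>fps_nth (disk_fps s) i\<bar> * \<bar>fps_nth (disk_fps s ^ n) (k - i)\<bar>)"
    by (simp add: fps_mult_nth order_trans[OF sum_abs] abs_mult)
  also have "\<dots> \<le> (\<Sum>i=0..k. real (k + 1) ^ n * a ^ k / a ^ Suc n)"
  proof (rule sum_mono)
    fix i assume i: "i \<in> {0..k}"
    have "\<bar>fps_nth (disk_fps s) i\<bar> * \<bar>fps_nth (disk_fps s ^ n) (k - i)\<bar>
        \<le> (a ^ i / a) * (real (k - i + 1) ^ n * a ^ (k - i) / a ^ n)"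
      using assms by (intro mult_mono base Suc) auto
    also have "\<dots> \<le> (a ^ i / a) * (real (k + 1) ^ n * a ^ (k - i) / a ^ n)"
      using assms by (intro mult_left_mono divide_right_mono mult_right_mono power_mono) auto
    also have "\<dots> = real (k + 1) ^ n * a ^ k / a ^ Suc n"
      using i by (simp add: power_add[symmetric])
    finally show "\<bar>fps_nth (disk_fps s) i\<bar> * \<bar>fps_nth (disk_fps s ^ n) (k - i)\<bar>
        \<le> real (k + 1) ^ n * a ^ k / a ^ Suc n" .
  qed
  also have "\<dots> = real (k + 1) ^ Suc n * a ^ k / a ^ Suc n"
    by simp
  finally show ?case .
qed

section \<open>The energy estimate\<close>

text \<open>After multiplication by \<open>exp (- L * t)\<close> the shifted function is
  nonincreasing. The constant \<open>e\<close> makes room for the boundary term left by summation by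
  parts.\<close>

lemma gronwall_shifted:
  fixes f f' :: "real \<Rightarrow> real"
  assumes "0 \<le> b"
    and deriv: "\<And>t. 0 \<le> t \<Longrightarrow> t \<le> b \<Longrightarrow> (f has_real_derivative f' t) (at t)"
    and le: "\<And>t. 0 \<le> t \<Longrightarrow> t \<le> b \<Longrightarrow> f' t \<le> L * (f t + e)"
  shows "f b + e \<le> exp (L * b) * (f 0 + e)"
proof -
  have "exp (- L * b) * (f b + e) \<le> exp (- L * 0) * (f 0 + e)"
  proof (rule DERIV_nonpos_imp_nonincreasing[OF \<open>0 \<le> b\<close>])
    fix t assume t: "0 \<le> t" "t \<le> b"
    have "((\<lambda>t. exp (- L * t) * (f t + e)) has_real_derivative
        exp (- L * t) * (f' t - L * (f t + e))) (at t)"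
      by (auto intro!: derivative_eq_intros deriv[OF t] simp: algebra_simps)
    moreover have "exp (- L * t) * (f' t - L * (f t + e)) \<le> 0"
      using le[OF t] by (simp add: mult_nonneg_nonpos)
    ultimately show "\<exists>y. ((\<lambda>t. exp (- L * t) * (f t + e)) has_real_derivative y) (at t) \<and> y \<le> 0"
      by blast
  qed
  then have "exp (L * b) * (exp (- L * b) * (f b + e)) \<le> exp (L * b) * (f 0 + e)"
    by simp
  then show ?thesis
    by (simp add: exp_minus mult.assoc[symmetric])
qed

text \<open>Summation by parts: the real part of \<open>\<langle>flow_gen x, x\<rangle>\<close> on the first \<open>K + 1\<close> coefficients,
  up to a boundary term, only sees the weights through \<open>(k + 1) \<beta>\<^sub>k\<^sup>2 - k \<beta>\<^sub>k\<^sub>+\<^sub>1\<^sup>2\<close>.\<close>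

lemma energy_telescope:
  fixes x b :: "nat \<Rightarrow> real"
  shows "(\<Sum>k\<le>K. x k * (b k)\<^sup>2 * (real (k + 1) * x (k + 1) - real (k - 1) * x (k - 1)))
       = real (K + 1) * (x K * x (K + 1)) * (b K)\<^sup>2
         + (\<Sum>k<K. x k * x (k + 1) * (real (k + 1) * (b k)\<^sup>2 - real k * (b (k + 1))\<^sup>2))"
  by (induction K) (simp_all add: algebra_simps)

lemma sum_consecutive_products_le:
  fixes y :: "nat \<Rightarrow> real"
  shows "(\<Sum>k<K. y k * y (k + 1)) \<le> (\<Sum>k\<le>K. (y k)\<^sup>2)"
proof -
  \<comment> \<open>The subtracted half square is the share of \<open>y K\<close> in the next
    product; with it the induction closes.\<close>
  have "(\<Sum>k<K. y k * y (k + 1)) \<le> (\<Sum>k\<le>K. (y k)\<^sup>2) - (y K)\<^sup>2 / 2"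
  proof (induction K)
    case (Suc K)
    have "0 \<le> (y K - y (Suc K))\<^sup>2" by simp
    then show ?case
      using Suc by (simp add: power2_diff)
  qed simp
  then show ?thesis
    by (smt (verit) divide_nonneg_nonneg zero_le_power2)
qed

lemma poly_times_power_tendsto_0:
  fixes a :: real
  assumes "0 < a" "a < 1"
  shows "(\<lambda>K. (real K + 2) ^ p * a ^ K) \<longlonglongrightarrow> 0"
  using assms by real_asymp

section \<open>Growth of the weight products\<close>

lemma weight_prod_0 [simp]: "weight_prod w 0 = 1"
  by (simp add: weight_prod_def)

lemma weight_prod_Suc: "weight_prod w (Suc k) = weight_prod w k * w (Suc k)"
  by (simp add: weight_prod_def)

locale growth_weights =
  fixes w :: "nat \<Rightarrow> real"
  assumes weights: "weight_seq w" and growth: "polynomial_growth w"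
begin

abbreviation \<beta> :: "nat \<Rightarrow> real"
  where "\<beta> \<equiv> weight_prod w"

lemma w_pos: "w (Suc k) > 0"
  using weights by (simp add: weight_seq_def)

lemma w_lim: "w \<longlonglongrightarrow> 1"
  using weights by (simp add: weight_seq_def)

lemma \<beta>_pos [simp]: "\<beta> k > 0"
  by (induction k) (simp_all add: weight_prod_Suc w_pos)

lemma \<beta>_nonneg [simp]: "0 \<le> \<beta> k"
  by (rule less_imp_le) simp

lemma \<beta>_nz [simp]: "\<beta> k \<noteq> 0"
  using \<beta>_pos[of k] by linarith

text \<open>Only finitely many factors \<open>w i\<close> exceed \<open>\<rho>\<close>, and their
  total excess is a constant independent of \<open>j\<close> and \<open>n\<close>.\<close>

lemma \<beta>_ratio_bound:
  assumes "1 < \<rho>"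
  obtains C where "1 \<le> C" "\<And>j n. \<beta> (j + n) \<le> C * \<rho> ^ n * \<beta> j"
proof -
  obtain I where I: "\<And>i. i \<ge> I \<Longrightarrow> w i < \<rho>"
    using order_tendstoD(2)[OF w_lim assms] by (auto simp: eventually_sequentially)
  \<comment> \<open>The excess of \<open>w i\<close> over \<open>\<rho>\<close>, cut off below at 1,
    so that the products \<open>B\<close> are nondecreasing and constant from \<open>I\<close>
    on.\<close>
  define v where "v i = max 1 (w i / \<rho>)" for i
  define B where "B m = (\<Prod>i=1..m. v i)" for m
  have v1: "1 \<le> v i" and wv: "w i \<le> \<rho> * v i" for i
    using assms by (auto simp: v_def field_simps max_def)
  have B_Suc: "B (Suc m) = B m * v (Suc m)" for m
    by (simp add: B_def)
  have B1: "1 \<le> B m" for m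
    unfolding B_def by (rule prod_ge_1) (use v1 in auto)
  have B_mono: "B m \<le> B (Suc m)" for m
    using mult_left_mono[OF v1[of "Suc m"], of "B m"] B1[of m] by (simp add: B_Suc)
  have B_const: "B (Suc m) = B m" if "m \<ge> I" for m
    using I[of "Suc m"] that assms by (simp add: B_Suc v_def)
  have B_le: "B m \<le> B I" for m
  proof (cases "m \<le> I")
    case True
    then show ?thesis
      using lift_Suc_mono_le[of B m I] B_mono by blast
  next
    case False
    then have "I \<le> m" by simp
    then have "B m = B I"
      by (induction m rule: dec_induct) (simp_all add: B_const)
    then show ?thesis by simp
  qed
  \<comment> \<open>The quotient of \<open>\<beta> m\<close> by \<open>B m\<close> grows by a factor
    of at most \<open>\<rho>\<close> per step; the claim is stated without division.\<close>
  have main: "\<beta> (j + n) * B j \<le> \<rho> ^ n * \<beta> j * B (j + n)" for j n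
  proof (induction n)
    case (Suc n)
    have "\<beta> (j + Suc n) * B j = (\<beta> (j + n) * B j) * w (Suc (j + n))"
      by (simp add: weight_prod_Suc)
    also have "\<dots> \<le> (\<rho> ^ n * \<beta> j * B (j + n)) * (\<rho> * v (Suc (j + n)))"
    proof (rule mult_mono[OF Suc wv])
      have "0 \<le> B (j + n)"
        using B1[of "j + n"] by linarith
      then show "0 \<le> \<rho> ^ n * \<beta> j * B (j + n)"
        using assms by (intro mult_nonneg_nonneg) auto
    qed (use w_pos[of "j + n"] in simp)
    also have "\<dots> = \<rho> ^ Suc n * \<beta> j * B (j + Suc n)"
      by (simp add: B_Suc)
    finally show ?case .
  qed simp
  show thesis
  proof
    show "1 \<le> B I" by (rule B1)
    fix j n
    have "\<beta> (j + n) * 1 \<le> \<beta> (j + n) * B j"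
      by (intro mult_left_mono B1) simp
    also have "\<dots> \<le> \<rho> ^ n * \<beta> j * B (j + n)" by (rule main)
    also have "\<dots> \<le> \<rho> ^ n * \<beta> j * B I"
      using assms by (intro mult_left_mono B_le) simp
    finally show "\<beta> (j + n) \<le> B I * \<rho> ^ n * \<beta> j"
      by (simp add: mult_ac)
  qed
qed

text \<open>The only place where polynomial growth is used.\<close>

lemma flow_weight_bound:
  obtains D where "1 \<le> D"
    "\<And>k. \<bar>real (k + 1) * (\<beta> k)\<^sup>2 - real k * (\<beta> (k + 1))\<^sup>2\<bar> \<le> D * (\<beta> k * \<beta> (k + 1))"
proof -
  obtain M where "\<And>k. k \<ge> 1 \<Longrightarrow> real (k + 1) * \<bar>w k - 1\<bar> \<le> M"
    using growth by (auto simp: polynomial_growth_def bdd_above_def)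
  then have M: "real (k + 2) * \<bar>w (Suc k) - 1\<bar> \<le> M" for k
    by (metis Suc_1 Suc_eq_plus1 add_Suc_right le_add2)
  have M0: "0 \<le> M"
    using M[of 0] by (smt (verit) abs_ge_zero mult_nonneg_nonneg of_nat_0_le_iff)
  have "(\<lambda>k. inverse (w (Suc k))) \<longlonglongrightarrow> inverse 1"
    by (intro tendsto_inverse LIMSEQ_Suc w_lim) simp
  then have "Bseq (\<lambda>k. inverse (w (Suc k)))"
    by (rule convergent_imp_Bseq[OF convergentI])
  then obtain R where R: "0 < R" "\<And>k. \<bar>inverse (w (Suc k))\<bar> \<le> R"
    by (auto simp: Bseq_def)
  \<comment> \<open>\<open>R\<close> bounds \<open>1 / u\<close> and \<open>M\<close> bounds
    \<open>k * \<bar>1 - u\<bar>\<close> for \<open>u = w (Suc k)\<close>; the summand 1 ensures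
    \<open>1 \<le> D\<close>.\<close>
  define D where "D = 1 + R + (1 + R) * M"
  have D1: "1 \<le> D"
    using R M0 by (simp add: D_def)
  show thesis
  proof
    show "1 \<le> D" by (rule D1)
    fix k
    define u where "u = w (Suc k)"
    have u: "u > 0" "inverse u \<le> R"
      using w_pos[of k] R(2)[of k] by (auto simp: u_def)
    have Mu: "real k * \<bar>1 - u\<bar> \<le> M"
      using M[of k] by (smt (verit) abs_ge_zero abs_minus_commute mult_right_mono of_nat_mono
          le_add1 u_def)
    \<comment> \<open>Division by \<open>\<beta> k * \<beta> (k + 1)\<close> leaves
      \<open>(k + 1) / u - k * u\<close>. The terms of order \<open>k\<close> combine into a
      multiple of \<open>1 - u\<close>, which polynomial growth controls.\<close>
    have "real (k + 1) * (\<beta> k)\<^sup>2 - real k * (\<beta> (k + 1))\<^sup>2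
        = (inverse u + real k * (1 - u) * (1 + inverse u)) * (\<beta> k * \<beta> (k + 1))"
      using u by (simp add: weight_prod_Suc u_def[symmetric] power2_eq_square field_simps)
    moreover have "\<bar>inverse u + real k * (1 - u) * (1 + inverse u)\<bar> \<le> D"
    proof -
      have "\<bar>real k * (1 - u) * (1 + inverse u)\<bar> = (real k * \<bar>1 - u\<bar>) * (1 + inverse u)"
        using u by (simp add: abs_mult)
      also have "\<dots> \<le> M * (1 + R)"
        using u Mu M0 by (intro mult_mono) auto
      finally show ?thesis
        using u by (simp add: D_def mult.commute[of M]) (smt (verit) positive_imp_inverse_positive)
    qed
    ultimately show "\<bar>real (k + 1) * (\<beta> k)\<^sup>2 - real k * (\<beta> (k + 1))\<^sup>2\<bar> \<le> D * (\<beta> k * \<beta> (k + 1))"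
      by (simp add: abs_mult mult_right_mono)
  qed
qed

text \<open>Gronwall's inequality is applied along the flow from 0 to \<open>s\<close> to the
  weighted square sum of the first coefficients of the composed polynomial. The constant depends on
  neither the degree nor the truncation \<open>K\<close>, which later permits both limits.\<close>

lemma disk_fps_polynomial_bound:
  fixes s :: real
  assumes "0 \<le> s" "s < 1"
  obtains C where "0 < C"
    "\<And>(c :: nat \<Rightarrow> real) N K. (\<Sum>k\<le>K. (\<Sum>n<N. c n * fps_nth (disk_fps s ^ n) k)\<^sup>2 * (\<beta> k)\<^sup>2)
        \<le> C * (\<Sum>n<N. (c n)\<^sup>2 * (\<beta> n)\<^sup>2)"
proof -
  \<comment> \<open>An upper bound for the flow parameter that stays positive, since powers of
    \<open>a\<close> occur as denominators.\<close>
  define a where "a = max s (1/2)"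
  have a: "0 < a" "a < 1" "s \<le> a"
    using assms by (auto simp: a_def)
  have a2: "0 < 1 - a\<^sup>2"
    using a abs_square_less_1[of a] by linarith
  obtain D where D: "1 \<le> D"
    "\<And>k. \<bar>real (k + 1) * (\<beta> k)\<^sup>2 - real k * (\<beta> (k + 1))\<^sup>2\<bar> \<le> D * (\<beta> k * \<beta> (k + 1))"
    using flow_weight_bound by blast
  \<comment> \<open>The 2 comes from differentiating squares, \<open>D\<close> from the weights, and
    the denominator from the change of variable between \<open>t\<close> and tanh \<open>t\<close>,
    uniformly on [0, \<open>a\<close>].\<close>
  define L where "L = 2 * D / (1 - a\<^sup>2)"
  have L0: "0 \<le> L"
    using D a2 by (simp add: L_def)
  \<comment> \<open>Chosen so that \<open>\<rho>\<^sup>2 * a = 1\<close>: the weights at most double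
    the logarithmic rate available, and \<open>(\<beta> K)\<^sup>2 * (a ^ K)\<^sup>2\<close> still
    decays like \<open>a ^ K\<close>.\<close>
  define \<rho> where "\<rho> = 1 / sqrt a"
  have \<rho>: "1 < \<rho>" "\<rho>\<^sup>2 * a = 1"
    using a by (auto simp: \<rho>_def power_divide)
  obtain C\<^sub>0 where C\<^sub>0: "1 \<le> C\<^sub>0" "\<And>j n. \<beta> (j + n) \<le> C\<^sub>0 * \<rho> ^ n * \<beta> j"
    using \<beta>_ratio_bound[OF \<rho>(1)] by blast
  have \<beta>2: "(\<beta> K)\<^sup>2 * (a ^ K)\<^sup>2 \<le> C\<^sub>0\<^sup>2 * a ^ K" for K
  proof -
    have "(\<beta> K)\<^sup>2 \<le> (C\<^sub>0 * \<rho> ^ K)\<^sup>2"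
      using C\<^sub>0(2)[of 0 K] by (intro power_mono) auto
    then have "(\<beta> K)\<^sup>2 * (a ^ K)\<^sup>2 \<le> (C\<^sub>0 * \<rho> ^ K)\<^sup>2 * (a ^ K)\<^sup>2"
      by (rule mult_right_mono) simp
    also have "\<dots> = C\<^sub>0\<^sup>2 * ((\<rho>\<^sup>2 * a) ^ K * a ^ K)"
      by (simp add: power_mult_distrib power2_eq_square mult_ac)
    finally show ?thesis
      by (simp add: \<rho>)
  qed
  show thesis
  proof
    show "0 < exp (L * s)" by simp
    fix c :: "nat \<Rightarrow> real" and N K :: nat
    \<comment> \<open>\<open>A k t\<close> is the \<open>k\<close>-th coefficient of the polynomial
      composed with the flow map, \<open>A'\<close> applies the generator, \<open>G\<close> is the
      truncated energy, and \<open>E K\<close> will dominate the boundary term for all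
      \<open>t\<close> in [0, \<open>s\<close>].\<close>
    define A where "A k t = (\<Sum>n<N. c n * fps_nth (disk_fps t ^ n) k)" for k t
    define A' where "A' k t = real (k + 1) * A (k + 1) t - real (k - 1) * A (k - 1) t" for k t
    define G where "G K t = (\<Sum>k\<le>K. (A k t)\<^sup>2 * (\<beta> k)\<^sup>2)" for K t
    define Q where "Q = (\<Sum>n<N. \<bar>c n\<bar> / a ^ n)"
    define E where "E K = real (K + 1) * ((Q * real (K + 2) ^ N)\<^sup>2 * (C\<^sub>0\<^sup>2 * a ^ K))" for K
    have A_deriv: "((\<lambda>t. A k t) has_real_derivative A' k t / (1 - t\<^sup>2)) (at t)"
      if "0 \<le> t" "t \<le> s" for k t
    proof -
      have "((\<lambda>t. A k t) has_real_derivative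
          (\<Sum>n<N. c n * (fps_nth (flow_gen (disk_fps t ^ n)) k / (1 - t\<^sup>2)))) (at t)"
        unfolding A_def using that assms
        by (intro DERIV_sum DERIV_cmult disk_fps_power_nth_deriv) auto
      also have "(\<Sum>n<N. c n * (fps_nth (flow_gen (disk_fps t ^ n)) k / (1 - t\<^sup>2))) = A' k t / (1 - t\<^sup>2)"
        by (simp only: A'_def A_def flow_gen_nth sum_distrib_left sum_subtractf[symmetric]
            sum_divide_distrib) (auto intro!: sum.cong simp: algebra_simps)
      finally show ?thesis .
    qed
    have A_bound: "\<bar>A k t\<bar> \<le> Q * real (k + 1) ^ N * a ^ k" if "0 \<le> t" "t \<le> s" for k t
    proof -
      have "\<bar>A k t\<bar> \<le> (\<Sum>n<N. \<bar>c n\<bar> * \<bar>fps_nth (disk_fps t ^ n) k\<bar>)"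
        unfolding A_def by (rule order_trans[OF sum_abs]) (simp add: abs_mult)
      also have "\<dots> \<le> (\<Sum>n<N. \<bar>c n\<bar> / a ^ n * (real (k + 1) ^ N * a ^ k))"
      proof (rule sum_mono)
        fix n assume n: "n \<in> {..<N}"
        have "\<bar>fps_nth (disk_fps t ^ n) k\<bar> \<le> real (k + 1) ^ n * a ^ k / a ^ n"
          using that a by (intro disk_fps_power_nth_bound) auto
        also have "\<dots> \<le> real (k + 1) ^ N * a ^ k / a ^ n"
          using n a by (intro divide_right_mono mult_right_mono power_increasing) auto
        finally have "\<bar>c n\<bar> * \<bar>fps_nth (disk_fps t ^ n) k\<bar> \<le> \<bar>c n\<bar> * (real (k + 1) ^ N * a ^ k / a ^ n)"
          by (rule mult_left_mono) simp
        then show "\<bar>c n\<bar> * \<bar>fps_nth (disk_fps t ^ n) k\<bar> \<le> \<bar>c n\<bar> / a ^ n * (real (k + 1) ^ N * a ^ k)"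
          by simp
      qed
      finally show ?thesis
        by (simp only: Q_def sum_distrib_right mult.assoc)
    qed
    have Q0: "0 \<le> Q"
      unfolding Q_def using a by (intro sum_nonneg) auto
    have boundary: "real (K + 1) * (A K t * A (K + 1) t) * (\<beta> K)\<^sup>2 \<le> E K"
      if "0 \<le> t" "t \<le> s" for K t
    proof -
      let ?q = "Q * real (K + 2) ^ N"
      have 1: "\<bar>A K t\<bar> \<le> ?q * a ^ K"
        using a Q0 by (intro order_trans[OF A_bound[OF that]] mult_right_mono mult_left_mono power_mono) auto
      have 2: "\<bar>A (K + 1) t\<bar> \<le> ?q * a ^ K"
      proof -
        have "\<bar>A (K + 1) t\<bar> \<le> ?q * a ^ (K + 1)"
          using A_bound[OF that, of "K + 1"] by simp
        also have "\<dots> \<le> ?q * a ^ K"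
          using a Q0 by (intro mult_left_mono power_decreasing) auto
        finally show ?thesis .
      qed
      have "A K t * A (K + 1) t \<le> \<bar>A K t\<bar> * \<bar>A (K + 1) t\<bar>"
        by (metis abs_ge_self abs_mult)
      also have "\<dots> \<le> (?q * a ^ K) * (?q * a ^ K)"
        using a Q0 by (intro mult_mono 1 2) auto
      finally have "A K t * A (K + 1) t * (\<beta> K)\<^sup>2 \<le> (?q * a ^ K) * (?q * a ^ K) * (\<beta> K)\<^sup>2"
        by (rule mult_right_mono) simp
      also have "\<dots> = ?q\<^sup>2 * ((\<beta> K)\<^sup>2 * (a ^ K)\<^sup>2)"
        by (simp add: power2_eq_square mult_ac)
      also have "\<dots> \<le> ?q\<^sup>2 * (C\<^sub>0\<^sup>2 * a ^ K)"
        by (intro mult_left_mono \<beta>2) simp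
      finally show ?thesis
        unfolding E_def mult.assoc by (intro mult_left_mono) (simp_all add: mult_ac)
    qed
    have E0: "0 \<le> E K" for K
      using a by (simp add: E_def)
    have E_lim: "E \<longlonglongrightarrow> 0"
    proof -
      have "(\<lambda>K. Q\<^sup>2 * C\<^sub>0\<^sup>2 * ((real K + 2) ^ (2 * N + 1) * a ^ K)) \<longlonglongrightarrow> Q\<^sup>2 * C\<^sub>0\<^sup>2 * 0"
        by (intro tendsto_mult tendsto_const poly_times_power_tendsto_0 a)
      moreover have "E K \<le> Q\<^sup>2 * C\<^sub>0\<^sup>2 * ((real K + 2) ^ (2 * N + 1) * a ^ K)" for K
      proof -
        have "E K \<le> (real K + 2) * ((Q * real (K + 2) ^ N)\<^sup>2 * (C\<^sub>0\<^sup>2 * a ^ K))"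
          unfolding E_def using a by (intro mult_right_mono) auto
        also have "\<dots> = Q\<^sup>2 * C\<^sub>0\<^sup>2 * ((real K + 2) ^ (2 * N + 1) * a ^ K)"
          by (simp add: power_mult_distrib power_mult[symmetric] power_add mult_ac add.commute[of 2])
        finally show ?thesis .
      qed
      ultimately show ?thesis
        using E0 by (intro tendsto_sandwich[of "\<lambda>_. 0" E]) auto
    qed
    \<comment> \<open>The error \<open>E K\<close> does not depend on \<open>t\<close>, so it can
      serve as the shift in Gronwall's inequality.\<close>
    have G_bound: "G K s + E K \<le> exp (L * s) * (G K 0 + E K)" for K
    proof (rule gronwall_shifted[OF assms(1)])
      fix t assume t: "0 \<le> t" "t \<le> s"
      show "(G K has_real_derivative
          (\<Sum>k\<le>K. 2 * A k t * (A' k t / (1 - t\<^sup>2)) * (\<beta> k)\<^sup>2)) (at t)"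
        unfolding G_def by (auto intro!: derivative_eq_intros A_deriv[OF t] sum.cong)
      have t2: "0 < 1 - t\<^sup>2" "1 - a\<^sup>2 \<le> 1 - t\<^sup>2"
        using t a a2 power_mono[of t a 2] by linarith+
      have G0: "0 \<le> G K t"
        unfolding G_def by (intro sum_nonneg) simp
      have "(\<Sum>k\<le>K. 2 * A k t * (A' k t / (1 - t\<^sup>2)) * (\<beta> k)\<^sup>2)
          = 2 / (1 - t\<^sup>2) * (\<Sum>k\<le>K. A k t * (\<beta> k)\<^sup>2 * A' k t)"
        unfolding sum_distrib_left by (intro sum.cong refl) simp
      also have "\<dots> \<le> 2 / (1 - t\<^sup>2) * (D * (G K t + E K))"
      proof -
        have "(\<Sum>k<K. A k t * A (k + 1) t * (real (k + 1) * (\<beta> k)\<^sup>2 - real k * (\<beta> (k + 1))\<^sup>2))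
            \<le> (\<Sum>k<K. D * ((\<bar>A k t\<bar> * \<beta> k) * (\<bar>A (k + 1) t\<bar> * \<beta> (k + 1))))"
        proof (rule sum_mono)
          fix k
          have "A k t * A (k + 1) t * (real (k + 1) * (\<beta> k)\<^sup>2 - real k * (\<beta> (k + 1))\<^sup>2)
              \<le> \<bar>A k t\<bar> * \<bar>A (k + 1) t\<bar> * \<bar>real (k + 1) * (\<beta> k)\<^sup>2 - real k * (\<beta> (k + 1))\<^sup>2\<bar>"
            by (metis abs_ge_self abs_mult)
          also have "\<dots> \<le> \<bar>A k t\<bar> * \<bar>A (k + 1) t\<bar> * (D * (\<beta> k * \<beta> (k + 1)))"
            by (intro mult_left_mono D) simp
          finally show "A k t * A (k + 1) t * (real (k + 1) * (\<beta> k)\<^sup>2 - real k * (\<beta> (k + 1))\<^sup>2)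
              \<le> D * ((\<bar>A k t\<bar> * \<beta> k) * (\<bar>A (k + 1) t\<bar> * \<beta> (k + 1)))"
            by (simp add: mult_ac)
        qed
        also have "\<dots> \<le> D * (\<Sum>k\<le>K. (\<bar>A k t\<bar> * \<beta> k)\<^sup>2)"
          unfolding sum_distrib_left[symmetric]
          using D(1) by (intro mult_left_mono sum_consecutive_products_le) simp
        also have "\<dots> = D * G K t"
          by (simp add: G_def power_mult_distrib)
        finally have 1: "(\<Sum>k<K. A k t * A (k + 1) t * (real (k + 1) * (\<beta> k)\<^sup>2 - real k * (\<beta> (k + 1))\<^sup>2))
            \<le> D * G K t" .
        \<comment> \<open>By \<open>1 \<le> D\<close> the boundary term and the interior sum get the
          common factor \<open>D\<close>.\<close>
        have 2: "E K \<le> D * E K"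
          using mult_right_mono[OF D(1) E0[of K]] by simp
        have "(\<Sum>k\<le>K. A k t * (\<beta> k)\<^sup>2 * A' k t) \<le> D * (G K t + E K)"
          using energy_telescope[of "\<lambda>k. A k t" \<beta> K] 1 2 boundary[OF t, of K]
          unfolding A'_def distrib_left by linarith
        then show ?thesis
          using t2 by (intro mult_left_mono) auto
      qed
      also have "\<dots> \<le> 2 / (1 - a\<^sup>2) * (D * (G K t + E K))"
        using t2 a2 D G0 E0[of K] by (intro mult_right_mono divide_left_mono) auto
      also have "\<dots> = L * (G K t + E K)"
        by (simp add: L_def)
      finally show "(\<Sum>k\<le>K. 2 * A k t * (A' k t / (1 - t\<^sup>2)) * (\<beta> k)\<^sup>2) \<le> L * (G K t + E K)" .
    qed
    \<comment> \<open>At parameter 0 the flow map is the identity, so the energy is a truncation of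
      the norm of the polynomial.\<close>
    have G_0: "G K 0 \<le> (\<Sum>n<N. (c n)\<^sup>2 * (\<beta> n)\<^sup>2)" for K
    proof -
      have A0: "A k 0 = (if k < N then c k else 0)" for k
        by (simp add: A_def disk_fps_0 fps_X_power_nth if_distrib[of "\<lambda>x. _ * x"] sum.delta cong: if_cong)
      have "G K 0 = (\<Sum>k\<in>{..K} \<inter> {..<N}. (c k)\<^sup>2 * (\<beta> k)\<^sup>2)"
        unfolding G_def A0 by (intro sum.mono_neutral_cong_right) auto
      also have "\<dots> \<le> (\<Sum>n<N. (c n)\<^sup>2 * (\<beta> n)\<^sup>2)"
        by (intro sum_mono2) auto
      finally show ?thesis .
    qed
    \<comment> \<open>The energy increases with the truncation, so \<open>K\<close> stays fixed on
      the left while \<open>K'\<close> tends to infinity on the right and removes the error.\<close>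
    have "G K s \<le> exp (L * s) * (\<Sum>n<N. (c n)\<^sup>2 * (\<beta> n)\<^sup>2)"
    proof (rule tendsto_lowerbound)
      show "(\<lambda>K'. exp (L * s) * ((\<Sum>n<N. (c n)\<^sup>2 * (\<beta> n)\<^sup>2) + E K')) \<longlonglongrightarrow>
          exp (L * s) * (\<Sum>n<N. (c n)\<^sup>2 * (\<beta> n)\<^sup>2)"
        by (auto intro!: tendsto_eq_intros E_lim)
      show "\<forall>\<^sub>F K' in sequentially. G K s \<le> exp (L * s) * ((\<Sum>n<N. (c n)\<^sup>2 * (\<beta> n)\<^sup>2) + E K')"
        using eventually_ge_at_top[of K]
      proof eventually_elim
        case (elim K')
        have "G K s \<le> G K' s"
          unfolding G_def using elim by (intro sum_mono2) auto
        also have "\<dots> \<le> exp (L * s) * (G K' 0 + E K')"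
          using G_bound[of K'] E0[of K'] by linarith
        also have "\<dots> \<le> exp (L * s) * ((\<Sum>n<N. (c n)\<^sup>2 * (\<beta> n)\<^sup>2) + E K')"
          by (intro mult_left_mono add_right_mono G_0) simp
        finally show ?case .
      qed
    qed simp
    then show "(\<Sum>k\<le>K. (\<Sum>n<N. c n * fps_nth (disk_fps s ^ n) k)\<^sup>2 * (\<beta> k)\<^sup>2)
        \<le> exp (L * s) * (\<Sum>n<N. (c n)\<^sup>2 * (\<beta> n)\<^sup>2)"
      by (simp add: G_def A_def)
  qed
qed

end

section \<open>Weighted Hardy spaces and composition operators\<close>

abbreviation coef :: "(complex \<Rightarrow> complex) \<Rightarrow> nat \<Rightarrow> complex"
  where "coef f k \<equiv> fps_nth (fps_expansion f 0) k"

abbreviation disk :: "complex set"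
  where "disk \<equiv> ball 0 1"

lemma coef_eqI: "f has_fps_expansion F \<Longrightarrow> coef f k = fps_nth F k"
  by (simp add: fps_expansion_eqI)

lemma disk_has_fps_expansion: "f holomorphic_on disk \<Longrightarrow> f has_fps_expansion fps_expansion f 0"
  by (rule has_fps_expansion_fps_expansion[of disk]) auto

lemma coef_cong:
  assumes "\<And>z. z \<in> disk \<Longrightarrow> f z = g z"
  shows "coef f k = coef g k"
proof -
  have "\<forall>\<^sub>F z in nhds 0. f z = g z"
    by (rule eventually_mono[OF eventually_nhds_in_open[of disk]]) (use assms in auto)
  then show ?thesis
    by (simp cong: fps_expansion_cong)
qed

lemma coef_sums:
  assumes "f holomorphic_on disk" "z \<in> disk"
  shows "(\<lambda>k. coef f k * z ^ k) sums f z"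
  using holomorphic_power_series[OF assms] by (simp add: fps_expansion_def)

lemma coef_add:
  assumes "f holomorphic_on disk" "g holomorphic_on disk"
  shows "coef (\<lambda>z. f z + g z) k = coef f k + coef g k"
  using assms by (subst coef_eqI) (auto intro!: fps_expansion_intros disk_has_fps_expansion)

lemma coef_cmult:
  assumes "f holomorphic_on disk"
  shows "coef (\<lambda>z. c * f z) k = c * coef f k"
  using assms by (subst coef_eqI) (auto intro!: fps_expansion_intros disk_has_fps_expansion)

lemma coef_power_mult:
  assumes "f holomorphic_on disk"
  shows "coef (\<lambda>z. z ^ n * f z) k = (if k < n then 0 else coef f (k - n))"
proof -
  have "(\<lambda>z. z ^ n * f z) has_fps_expansion fps_X ^ n * fps_expansion f 0"
    using assms by (auto intro!: fps_expansion_intros disk_has_fps_expansion)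
  from coef_eqI[OF this] show ?thesis
    by (simp add: fps_X_power_mult_nth)
qed

lemma coef_rotate:
  assumes f: "f holomorphic_on disk" and u: "norm u = 1"
  shows "coef (\<lambda>z. f (u * z)) k = coef f k * u ^ k"
proof -
  have "\<forall>\<^sub>F z in nhds 0. (\<lambda>k. coef f k * u ^ k * z ^ k) sums f (u * z)"
  proof (rule eventually_mono)
    show "\<forall>\<^sub>F z in nhds 0. z \<in> disk"
      by (rule eventually_nhds_in_open) auto
    fix z :: complex assume "z \<in> disk"
    then show "(\<lambda>k. coef f k * u ^ k * z ^ k) sums f (u * z)"
      using coef_sums[OF f, of "u * z"] u by (simp add: norm_mult power_mult_distrib mult_ac)
  qed
  then have "(\<lambda>z. f (u * z)) has_fps_expansion Abs_fps (\<lambda>k. coef f k * u ^ k)"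
    by (intro has_fps_expansionI) simp
  from coef_eqI[OF this] show ?thesis by simp
qed

lemma comp_op_holomorphic:
  assumes "\<phi> holomorphic_on disk" "\<phi> ` disk \<subseteq> disk" "f holomorphic_on disk"
  shows "comp_op \<phi> f holomorphic_on disk"
proof -
  have "(f \<circ> \<phi>) holomorphic_on disk"
    using assms by (intro holomorphic_on_compose_gen)
  then show ?thesis
    by (rule holomorphic_transform) (simp add: comp_op_def)
qed

lemma mult_op_holomorphic:
  assumes "g holomorphic_on disk" "f holomorphic_on disk"
  shows "mult_op g f holomorphic_on disk"
  by (rule holomorphic_transform[OF holomorphic_on_mult[OF assms]]) (simp add: mult_op_def)

text \<open>On the closed disk of radius 1/2 the values of \<open>\<phi>\<close> stay in a compact
  part of the unit disk, so composing the Taylor polynomials of \<open>f\<close> with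
  \<open>\<phi>\<close> gives uniform convergence there. Uniform limits of holomorphic functions may
  be differentiated termwise at 0.\<close>

lemma coef_comp_op_limit:
  assumes \<phi>: "\<phi> holomorphic_on disk" "\<phi> ` disk \<subseteq> disk" and f: "f holomorphic_on disk"
  shows "(\<lambda>N. \<Sum>n<N. coef f n * coef (\<lambda>z. \<phi> z ^ n) k) \<longlonglongrightarrow> coef (comp_op \<phi> f) k"
proof -
  have "continuous_on (cball 0 (1/2)) (\<lambda>z. norm (\<phi> z))"
    by (intro continuous_on_norm holomorphic_on_imp_continuous_on holomorphic_on_subset[OF \<phi>(1)]) auto
  then obtain z\<^sub>0 where z\<^sub>0: "z\<^sub>0 \<in> cball 0 (1/2)"
      "\<And>z. z \<in> cball 0 (1/2) \<Longrightarrow> norm (\<phi> z) \<le> norm (\<phi> z\<^sub>0)"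
    using continuous_attains_sup[of "cball 0 (1/2) :: complex set" "\<lambda>z. norm (\<phi> z)"]
    by (auto simp: cball_eq_empty)
  define r where "r = norm (\<phi> z\<^sub>0)"
  have r: "0 \<le> r" "r < 1"
    using \<phi>(2) z\<^sub>0(1) by (auto simp: r_def image_subset_iff)
  \<comment> \<open>The radius \<open>(1 + r) / 2\<close> lies strictly between \<open>r\<close> and
    1; convergence there gives absolute convergence at \<open>r\<close>.\<close>
  have "summable (\<lambda>n. norm (coef f n * of_real r ^ n))"
  proof (rule powser_insidea)
    show "summable (\<lambda>n. coef f n * of_real ((1 + r) / 2) ^ n)"
      using r by (intro sums_summable[OF coef_sums[OF f]]) (simp only: mem_ball dist_0_norm norm_of_real, simp)
    show "norm (of_real r :: complex) < norm (of_real ((1 + r) / 2) :: complex)"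
      using r by (simp only: norm_of_real) simp
  qed
  then have "uniform_limit (ball 0 (1/2)) (\<lambda>N z. \<Sum>n<N. coef f n * \<phi> z ^ n)
      (\<lambda>z. \<Sum>n. coef f n * \<phi> z ^ n) sequentially"
  proof (rule Weierstrass_m_test[rotated])
    fix n z assume "z \<in> ball (0::complex) (1/2)"
    then have "norm (\<phi> z) \<le> r"
      using z\<^sub>0(2)[of z] by (simp add: r_def)
    then show "norm (coef f n * \<phi> z ^ n) \<le> norm (coef f n * of_real r ^ n)"
      using r by (simp add: norm_mult norm_power mult_left_mono power_mono)
  qed
  then have lim: "uniform_limit (ball 0 (1/2)) (\<lambda>N z. \<Sum>n<N. coef f n * \<phi> z ^ n)
      (comp_op \<phi> f) sequentially"
  proof (rule uniform_limit_cong'[THEN iffD1, rotated -1])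
    fix z :: complex assume "z \<in> ball 0 (1/2)"
    then have "z \<in> disk" by simp
    then show "(\<Sum>n. coef f n * \<phi> z ^ n) = comp_op \<phi> f z"
      using coef_sums[OF f, of "\<phi> z"] \<phi>(2) by (simp add: comp_op_def sums_iff image_subset_iff)
  qed simp
  have hol: "(\<lambda>z. \<phi> z ^ n) holomorphic_on disk" for n
    by (intro holomorphic_intros \<phi>)
  have "(\<lambda>N. (deriv ^^ k) (\<lambda>z. \<Sum>n<N. coef f n * \<phi> z ^ n) 0 / fact k)
      \<longlonglongrightarrow> (deriv ^^ k) (comp_op \<phi> f) 0 / fact k"
    by (intro tendsto_divide tendsto_const higher_deriv_complex_uniform_limit[OF lim] always_eventually
        allI holomorphic_intros holomorphic_on_subset[OF \<phi>(1)]) auto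
  moreover have "(deriv ^^ k) (\<lambda>z. \<Sum>n<N. coef f n * \<phi> z ^ n) 0 / fact k
      = (\<Sum>n<N. coef f n * coef (\<lambda>z. \<phi> z ^ n) k)" for N
  proof -
    have "(\<lambda>z. \<Sum>n<N. coef f n * \<phi> z ^ n) has_fps_expansion
        (\<Sum>n<N. fps_const (coef f n) * fps_expansion (\<lambda>z. \<phi> z ^ n) 0)"
      by (intro fps_expansion_intros disk_has_fps_expansion hol)
    from coef_eqI[OF this, of k] show ?thesis
      by (simp add: fps_expansion_def fps_sum_nth)
  qed
  ultimately show ?thesis
    by (simp add: fps_expansion_def)
qed

section \<open>Norm and bounded operators on the weighted Hardy space\<close>

context growth_weights
begin

abbreviation H :: "(complex \<Rightarrow> complex) set"
  where "H \<equiv> hardy_space w"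

abbreviation N :: "(complex \<Rightarrow> complex) \<Rightarrow> real"
  where "N \<equiv> hardy_norm w"

abbreviation partial_norm :: "(complex \<Rightarrow> complex) \<Rightarrow> nat \<Rightarrow> real"
  where "partial_norm f K \<equiv> L2_set (\<lambda>k. norm (coef f k) * \<beta> k) {..<K}"

lemma H_holomorphic: "f \<in> H \<Longrightarrow> f holomorphic_on disk"
  by (simp add: hardy_space_def)

lemma H_outside: "f \<in> H \<Longrightarrow> z \<notin> disk \<Longrightarrow> f z = 0"
  by (simp add: hardy_space_def)

lemma N_nonneg [simp]: "f \<in> H \<Longrightarrow> 0 \<le> N f"
  by (auto simp: hardy_norm_def hardy_space_def intro!: suminf_nonneg)

lemma partial_norm_le:
  assumes "f \<in> H"
  shows "partial_norm f K \<le> N f"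
  unfolding L2_set_def hardy_norm_def power_mult_distrib
  using assms by (intro real_sqrt_le_mono sum_le_suminf) (auto simp: hardy_space_def)

text \<open>A uniform bound on finite sections yields summability and the norm bound at once, so
  later estimates need only finite sums and the triangle inequality for
  \<open>L2_set\<close>.\<close>

lemma H_memI:
  assumes "f holomorphic_on disk" "\<And>z. z \<notin> disk \<Longrightarrow> f z = 0"
    and le: "\<And>K. partial_norm f K \<le> B"
  shows "f \<in> H" "N f \<le> B"
proof -
  let ?s = "\<lambda>k. (norm (coef f k))\<^sup>2 * (\<beta> k)\<^sup>2"
  \<comment> \<open>The empty partial norm is 0.\<close>
  have B: "0 \<le> B"
    using le[of 0] by simp
  have bound: "(\<Sum>k<K. ?s k) \<le> B\<^sup>2" for K
    using le[of K] by (simp add: L2_set_def power_mult_distrib real_sqrt_le_iff' sqrt_le_D)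
  have sm: "summable ?s"
    by (rule summableI_nonneg_bounded[OF _ bound]) simp
  then show "f \<in> H"
    using assms by (auto simp: hardy_space_def)
  have "(\<Sum>k. ?s k) \<le> B\<^sup>2"
    by (rule suminf_le_const[OF sm bound])
  then show "N f \<le> B"
    unfolding hardy_norm_def using B by (intro real_le_lsqrt) auto
qed

lemma H_add:
  assumes "f \<in> H" "g \<in> H"
  shows "(\<lambda>z. f z + g z) \<in> H" "N (\<lambda>z. f z + g z) \<le> N f + N g"
proof -
  have hol: "(\<lambda>z. f z + g z) holomorphic_on disk" "\<And>z. z \<notin> disk \<Longrightarrow> f z + g z = 0"
    using assms[THEN H_holomorphic] assms by (auto intro!: holomorphic_intros simp: H_outside)
  have le: "partial_norm (\<lambda>z. f z + g z) K \<le> N f + N g" for K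
  proof -
    have "partial_norm (\<lambda>z. f z + g z) K
        \<le> L2_set (\<lambda>k. norm (coef f k) * \<beta> k + norm (coef g k) * \<beta> k) {..<K}"
      using assms unfolding distrib_right[symmetric]
      by (intro L2_set_mono) (auto simp: coef_add H_holomorphic intro!: mult_right_mono norm_triangle_ineq)
    also have "\<dots> \<le> partial_norm f K + partial_norm g K"
      by (rule L2_set_triangle_ineq)
    also have "\<dots> \<le> N f + N g"
      by (intro add_mono partial_norm_le assms)
    finally show ?thesis .
  qed
  show "(\<lambda>z. f z + g z) \<in> H"
    by (rule H_memI[OF hol le])
  show "N (\<lambda>z. f z + g z) \<le> N f + N g"
    by (rule H_memI[OF hol le])
qed

lemma H_cmult:
  assumes "f \<in> H"
  shows "(\<lambda>z. c * f z) \<in> H" "N (\<lambda>z. c * f z) \<le> norm c * N f"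
proof -
  have hol: "(\<lambda>z. c * f z) holomorphic_on disk" "\<And>z. z \<notin> disk \<Longrightarrow> c * f z = 0"
    using assms[THEN H_holomorphic] assms by (auto intro!: holomorphic_intros simp: H_outside)
  have le: "partial_norm (\<lambda>z. c * f z) K \<le> norm c * N f" for K
  proof -
    have "partial_norm (\<lambda>z. c * f z) K = norm c * partial_norm f K"
      using assms by (simp add: coef_cmult H_holomorphic norm_mult L2_set_right_distrib mult.assoc)
    also have "\<dots> \<le> norm c * N f"
      by (intro mult_left_mono partial_norm_le assms) simp
    finally show ?thesis .
  qed
  show "(\<lambda>z. c * f z) \<in> H"
    by (rule H_memI[OF hol le])
  show "N (\<lambda>z. c * f z) \<le> norm c * N f"
    by (rule H_memI[OF hol le])
qed

lemma bounded_op_mult_opI: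
  assumes "\<And>f. f \<in> H \<Longrightarrow> mult_op g f \<in> H \<and> N (mult_op g f) \<le> C * N f"
  shows "bounded_op H N (mult_op g)"
  using assms unfolding bounded_op_def
  by (auto simp: mult_op_def fun_eq_iff algebra_simps)

lemma bounded_op_comp_opI:
  assumes "\<And>f. f \<in> H \<Longrightarrow> comp_op \<phi> f \<in> H \<and> N (comp_op \<phi> f) \<le> C * N f"
  shows "bounded_op H N (comp_op \<phi>)"
  using assms unfolding bounded_op_def
  by (auto simp: comp_op_def fun_eq_iff)

lemma bounded_op_mem: "bounded_op H N T \<Longrightarrow> f \<in> H \<Longrightarrow> T f \<in> H"
  by (simp add: bounded_op_def)

lemma bounded_opE:
  assumes "bounded_op H N T"
  obtains C where "0 \<le> C" "\<And>f. f \<in> H \<Longrightarrow> N (T f) \<le> C * N f"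
proof -
  obtain C where C: "\<And>f. f \<in> H \<Longrightarrow> N (T f) \<le> C * N f"
    using assms unfolding bounded_op_def by blast
  have "N (T f) \<le> max C 0 * N f" if "f \<in> H" for f
    using C[OF that] mult_right_mono[of C "max C 0" "N f"] that by auto
  then show thesis
    using that[of "max C 0"] by simp
qed

lemma bounded_op_compose:
  assumes "bounded_op H N S" "bounded_op H N T"
  shows "bounded_op H N (\<lambda>f. S (T f))"
proof -
  obtain C where C: "0 \<le> C" "\<And>f. f \<in> H \<Longrightarrow> N (S f) \<le> C * N f"
    using bounded_opE[OF assms(1)] by blast
  obtain D where D: "\<And>f. f \<in> H \<Longrightarrow> N (T f) \<le> D * N f"
    using bounded_opE[OF assms(2)] by blast
  have "N (S (T f)) \<le> (C * D) * N f" if "f \<in> H" for f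
  proof -
    have "N (S (T f)) \<le> C * N (T f)"
      using C(2) bounded_op_mem[OF assms(2)] that by blast
    also have "\<dots> \<le> C * (D * N f)"
      using C(1) D that by (intro mult_left_mono) auto
    finally show ?thesis by simp
  qed
  then show ?thesis
    using assms unfolding bounded_op_def by auto
qed

text \<open>Operators are total functions but matter only on \<open>H\<close>. Linearity transfers
  because \<open>H\<close> is closed under sums and multiples.\<close>

lemma bounded_op_cong:
  assumes "\<And>f. f \<in> H \<Longrightarrow> S f = T f" "bounded_op H N S"
  shows "bounded_op H N T"
proof -
  have "T f = S f" "S f \<in> H" if "f \<in> H" for f
    using assms that by (auto simp: bounded_op_def)
  then show ?thesis
    using assms(2) H_add H_cmult unfolding bounded_op_def by simp
qed

lemma mult_op_affine_bounded:
  assumes "bounded_op H N (mult_op g)"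
  shows "bounded_op H N (mult_op (\<lambda>z. p * g z + q))"
proof -
  obtain C where C: "\<And>f. f \<in> H \<Longrightarrow> N (mult_op g f) \<le> C * N f"
    using bounded_opE[OF assms] by blast
  show ?thesis
  proof (rule bounded_op_mult_opI)
    fix f assume f: "f \<in> H"
    note g = bounded_op_mem[OF assms f]
    have eq: "mult_op (\<lambda>z. p * g z + q) f = (\<lambda>z. p * mult_op g f z + q * f z)"
      using H_outside[OF f] by (auto simp: mult_op_def fun_eq_iff algebra_simps)
    have "N (\<lambda>z. p * mult_op g f z + q * f z) \<le> norm p * N (mult_op g f) + norm q * N f"
      by (intro order_trans[OF H_add(2)] H_cmult add_mono g f)
    also have "\<dots> \<le> norm p * (C * N f) + norm q * N f"
      by (intro add_mono mult_left_mono C f) auto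
    finally show "mult_op (\<lambda>z. p * g z + q) f \<in> H \<and>
        N (mult_op (\<lambda>z. p * g z + q) f) \<le> (norm p * C + norm q) * N f"
      unfolding eq using H_add(1)[OF H_cmult(1)[OF g] H_cmult(1)[OF f]] by (simp add: algebra_simps)
  qed
qed

text \<open>Multiplication by \<open>z ^ n\<close> shifts coefficients, so its norm is governed by
  the ratios of \<open>\<beta> (k + n)\<close> to \<open>\<beta> k\<close>. One \<open>C\<close>
  serves all \<open>n\<close>, and \<open>\<rho>\<close> may be arbitrarily close to 1.\<close>

lemma mult_op_power_bound:
  assumes "1 < \<rho>"
  obtains C where "0 \<le> C"
    "\<And>f n. f \<in> H \<Longrightarrow> mult_op (\<lambda>z. z ^ n) f \<in> H \<and> N (mult_op (\<lambda>z. z ^ n) f) \<le> C * \<rho> ^ n * N f"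
proof -
  obtain C where C: "1 \<le> C" "\<And>j n. \<beta> (j + n) \<le> C * \<rho> ^ n * \<beta> j"
    using \<beta>_ratio_bound[OF assms] by blast
  have "mult_op (\<lambda>z. z ^ n) f \<in> H \<and> N (mult_op (\<lambda>z. z ^ n) f) \<le> C * \<rho> ^ n * N f"
    if f: "f \<in> H" for f n
  proof -
    have hol: "mult_op (\<lambda>z. z ^ n) f holomorphic_on disk"
      using f by (intro mult_op_holomorphic H_holomorphic holomorphic_intros)
    have co: "coef (mult_op (\<lambda>z. z ^ n) f) k = (if k < n then 0 else coef f (k - n))" for k
      using coef_power_mult[OF H_holomorphic[OF f], of n k]
      by (subst coef_cong[where g = "\<lambda>z. z ^ n * f z"]) (auto simp: mult_op_def)
    have "partial_norm (mult_op (\<lambda>z. z ^ n) f) K \<le> C * \<rho> ^ n * N f" for K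
    proof -
      let ?a = "\<lambda>k. norm (coef f k) * \<beta> (k + n)"
      have "(\<Sum>k<K. (norm (coef (mult_op (\<lambda>z. z ^ n) f) k) * \<beta> k)\<^sup>2)
          = (\<Sum>k\<in>{n..<K}. (?a (k - n))\<^sup>2)"
        by (rule sum.mono_neutral_cong_right) (auto simp: co)
      also have "\<dots> = (\<Sum>k<K - n. (?a k)\<^sup>2)"
        by (rule sum.reindex_bij_witness[of _ "\<lambda>k. k + n" "\<lambda>k. k - n"]) auto
      finally have "partial_norm (mult_op (\<lambda>z. z ^ n) f) K = L2_set ?a {..<K - n}"
        by (simp add: L2_set_def)
      also have "\<dots> \<le> L2_set (\<lambda>k. C * \<rho> ^ n * (norm (coef f k) * \<beta> k)) {..<K - n}"
      proof (rule L2_set_mono)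
        fix k
        have "norm (coef f k) * \<beta> (k + n) \<le> norm (coef f k) * (C * \<rho> ^ n * \<beta> k)"
          by (intro mult_left_mono C) simp
        then show "?a k \<le> C * \<rho> ^ n * (norm (coef f k) * \<beta> k)"
          by (simp add: mult_ac)
      qed simp
      also have "\<dots> = C * \<rho> ^ n * partial_norm f (K - n)"
        using C assms by (intro L2_set_right_distrib[symmetric]) simp
      also have "\<dots> \<le> C * \<rho> ^ n * N f"
        using C assms by (intro mult_left_mono partial_norm_le f) simp
      finally show ?thesis .
    qed
    then show ?thesis
      using H_memI[OF hol] by (auto simp: mult_op_def)
  qed
  then show thesis
    using that[of C] C(1) by simp
qed

lemma mult_op_power_bounded: "bounded_op H N (mult_op (\<lambda>z. z ^ n))"
proof -
  obtain C where "\<And>f n. f \<in> H \<Longrightarrow>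
      mult_op (\<lambda>z. z ^ n) f \<in> H \<and> N (mult_op (\<lambda>z. z ^ n) f) \<le> C * 2 ^ n * N f"
    by (rule mult_op_power_bound[of 2]) auto
  then show ?thesis
    by (rule bounded_op_mult_opI)
qed

lemma mult_op_id_bounded: "bounded_op H N (mult_op (\<lambda>z. z))"
  using mult_op_power_bounded[of 1] by simp

lemma comp_op_rotation_bounded:
  assumes "norm u = 1"
  shows "bounded_op H N (comp_op (\<lambda>z. u * z))"
proof (rule bounded_op_comp_opI)
  fix f assume f: "f \<in> H"
  have hol: "comp_op (\<lambda>z. u * z) f holomorphic_on disk"
    using f assms by (intro comp_op_holomorphic H_holomorphic holomorphic_intros) (auto simp: norm_mult)
  have "coef (comp_op (\<lambda>z. u * z) f) k = coef f k * u ^ k" for k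
    using coef_rotate[OF H_holomorphic[OF f] assms, of k]
    by (subst coef_cong[where g = "\<lambda>z. f (u * z)"]) (auto simp: comp_op_def)
  then have "partial_norm (comp_op (\<lambda>z. u * z) f) K \<le> 1 * N f" for K
    using partial_norm_le[OF f, of K] assms by (simp add: norm_mult norm_power)
  then show "comp_op (\<lambda>z. u * z) f \<in> H \<and> N (comp_op (\<lambda>z. u * z) f) \<le> 1 * N f"
    using H_memI[OF hol] by (auto simp: comp_op_def)
qed

text \<open>The polynomial estimate extends to \<open>H\<close> because each coefficient of the
  composition is a limit of finite combinations and the bound is independent of their
  length.\<close>

lemma comp_op_hyperbolic_bounded:
  assumes s: "0 \<le> s" "s < 1"
  shows "bounded_op H N (comp_op (\<lambda>z. (z + of_real s) / (1 + of_real s * z)))"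
proof -
  let ?\<phi> = "\<lambda>z::complex. (z + of_real s) / (1 + of_real s * z)"
  have M: "?\<phi> = Moebius_function 0 (- of_real s)"
    by (simp add: Moebius_function_def fun_eq_iff)
  have \<phi>: "?\<phi> holomorphic_on disk" "?\<phi> ` disk \<subseteq> disk"
    unfolding M using s Moebius_function_norm_lt_1[of "- of_real s"]
    by (auto intro!: Moebius_function_holomorphic)
  define m where "m k n = fps_nth (disk_fps s ^ n) k" for k n
  have coef_power: "coef (\<lambda>z. ?\<phi> z ^ n) k = of_real (m k n)" for k n
    by (simp only: coef_eqI[OF has_fps_expansion_disk_fps_power] disk_fps_of_real_power_nth m_def)
  obtain C where C: "0 < C"
    "\<And>(c :: nat \<Rightarrow> real) L K. (\<Sum>k\<le>K. (\<Sum>n<L. c n * m k n)\<^sup>2 * (\<beta> k)\<^sup>2)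
        \<le> C * (\<Sum>n<L. (c n)\<^sup>2 * (\<beta> n)\<^sup>2)"
    unfolding m_def using disk_fps_polynomial_bound[OF s] by blast
  \<comment> \<open>The matrix \<open>m\<close> is real, so real and imaginary parts of the
    coefficients are transformed separately and their squares add up.\<close>
  have poly: "(\<Sum>k\<le>K. (norm (\<Sum>n<L. c n * of_real (m k n)))\<^sup>2 * (\<beta> k)\<^sup>2)
      \<le> C * (\<Sum>n<L. (norm (c n))\<^sup>2 * (\<beta> n)\<^sup>2)" for c :: "nat \<Rightarrow> complex" and L K
  proof -
    have "(\<Sum>k\<le>K. (norm (\<Sum>n<L. c n * of_real (m k n)))\<^sup>2 * (\<beta> k)\<^sup>2)
        = (\<Sum>k\<le>K. (\<Sum>n<L. Re (c n) * m k n)\<^sup>2 * (\<beta> k)\<^sup>2)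
          + (\<Sum>k\<le>K. (\<Sum>n<L. Im (c n) * m k n)\<^sup>2 * (\<beta> k)\<^sup>2)"
      by (simp add: cmod_power2 distrib_right sum.distrib)
    also have "\<dots> \<le> C * (\<Sum>n<L. (Re (c n))\<^sup>2 * (\<beta> n)\<^sup>2) + C * (\<Sum>n<L. (Im (c n))\<^sup>2 * (\<beta> n)\<^sup>2)"
      by (intro add_mono C)
    also have "\<dots> = C * (\<Sum>n<L. (norm (c n))\<^sup>2 * (\<beta> n)\<^sup>2)"
      by (simp add: cmod_power2 distrib_right distrib_left sum.distrib)
    finally show ?thesis .
  qed
  show ?thesis
  proof (rule bounded_op_comp_opI)
    fix f assume f: "f \<in> H"
    have hol: "comp_op ?\<phi> f holomorphic_on disk"
      using f by (intro comp_op_holomorphic \<phi> H_holomorphic)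
    have lim: "(\<lambda>L. \<Sum>n<L. coef f n * of_real (m k n)) \<longlonglongrightarrow> coef (comp_op ?\<phi> f) k" for k
      using coef_comp_op_limit[OF \<phi> H_holomorphic[OF f], of k] by (simp only: coef_power)
    \<comment> \<open>For fixed \<open>K\<close> only finitely many coefficients occur, so
      coefficientwise convergence suffices.\<close>
    have "(\<Sum>k\<le>K. (norm (coef (comp_op ?\<phi> f) k))\<^sup>2 * (\<beta> k)\<^sup>2) \<le> C * (N f)\<^sup>2" for K
    proof (rule LIMSEQ_le_const2)
      show "(\<lambda>L. \<Sum>k\<le>K. (norm (\<Sum>n<L. coef f n * of_real (m k n)))\<^sup>2 * (\<beta> k)\<^sup>2)
          \<longlonglongrightarrow> (\<Sum>k\<le>K. (norm (coef (comp_op ?\<phi> f) k))\<^sup>2 * (\<beta> k)\<^sup>2)"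
        by (intro tendsto_intros lim)
      have "(\<Sum>k\<le>K. (norm (\<Sum>n<L. coef f n * of_real (m k n)))\<^sup>2 * (\<beta> k)\<^sup>2) \<le> C * (N f)\<^sup>2" for L
      proof -
        have "(\<Sum>n<L. (norm (coef f n))\<^sup>2 * (\<beta> n)\<^sup>2) = (partial_norm f L)\<^sup>2"
          by (simp add: L2_set_def power_mult_distrib sum_nonneg)
        also have "\<dots> \<le> (N f)\<^sup>2"
          using partial_norm_le[OF f] by (intro power_mono) auto
        finally show ?thesis
          by (intro order_trans[OF poly] mult_left_mono) (use C(1) in simp_all)
      qed
      then show "\<exists>n. \<forall>L\<ge>n. (\<Sum>k\<le>K. (norm (\<Sum>n<L. coef f n * of_real (m k n)))\<^sup>2 * (\<beta> k)\<^sup>2) \<le> C * (N f)\<^sup>2"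
        by blast
    qed
    then have "partial_norm (comp_op ?\<phi> f) K \<le> sqrt C * N f" for K
    proof -
      have "(\<Sum>k<K. (norm (coef (comp_op ?\<phi> f) k))\<^sup>2 * (\<beta> k)\<^sup>2)
          \<le> (\<Sum>k\<le>K. (norm (coef (comp_op ?\<phi> f) k))\<^sup>2 * (\<beta> k)\<^sup>2)"
        by (intro sum_mono2) auto
      also have "\<dots> \<le> C * (N f)\<^sup>2" by fact
      also have "\<dots> = (sqrt C * N f)\<^sup>2"
        using C(1) by (simp add: power_mult_distrib)
      finally show ?thesis
        using f C(1) unfolding L2_set_def power_mult_distrib
        by (intro real_le_lsqrt) (auto simp: power_mult_distrib)
    qed
    then show "comp_op ?\<phi> f \<in> H \<and> N (comp_op ?\<phi> f) \<le> sqrt C * N f"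
      using H_memI[OF hol] by (auto simp: comp_op_def)
  qed
qed

end

section \<open>Disk automorphisms and multiplication operators\<close>

lemma disk_aut_holomorphic: "\<phi> \<in> disk_aut \<Longrightarrow> \<phi> holomorphic_on disk"
  by (simp add: disk_aut_def)

lemma disk_aut_in_disk: "\<phi> \<in> disk_aut \<Longrightarrow> z \<in> disk \<Longrightarrow> \<phi> z \<in> disk"
  unfolding disk_aut_def bij_betw_def by blast

lemma disk_aut_inverse:
  assumes "\<phi> \<in> disk_aut"
  obtains \<psi> where "\<psi> \<in> disk_aut"
    "\<And>z. z \<in> disk \<Longrightarrow> \<psi> (\<phi> z) = z" "\<And>z. z \<in> disk \<Longrightarrow> \<phi> (\<psi> z) = z"
proof -
  have bij: "bij_betw \<phi> disk disk"
    using assms unfolding disk_aut_def by blast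
  note inj = bij_betw_imp_inj_on[OF bij] and im = bij_betw_imp_surj_on[OF bij]
  obtain \<psi> where \<psi>: "\<psi> holomorphic_on \<phi> ` disk" "\<And>z. z \<in> disk \<Longrightarrow> \<psi> (\<phi> z) = z"
    using holomorphic_has_inverse[OF disk_aut_holomorphic[OF assms] open_ball inj] by metis
  have right: "\<phi> (\<psi> z) = z" "\<psi> z \<in> disk" if "z \<in> disk" for z
  proof -
    have "z \<in> \<phi> ` disk"
      using that im by (simp only:)
    then obtain y where y: "z = \<phi> y" "y \<in> disk"
      by (rule imageE)
    show "\<phi> (\<psi> z) = z" "\<psi> z \<in> disk"
      by (simp_all only: y(1) \<psi>(2)[OF y(2)] y(2))
  qed
  have "bij_betw \<psi> disk disk"
    using right \<psi>(2) disk_aut_in_disk[OF assms]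
    by (intro bij_betw_byWitness[where f' = \<phi>] ballI image_subsetI)
  then have "\<psi> \<in> disk_aut"
    using \<psi>(1) unfolding disk_aut_def im by blast
  then show thesis
    by (rule that) (rule \<psi>(2) right(1), assumption)+
qed

lemma moebius_denominator_nonzero:
  assumes "norm b < 1" "z \<in> disk"
  shows "1 - b * z \<noteq> (0 :: complex)"
proof
  assume "1 - b * z = 0"
  then have "norm (b * z) = 1" by simp
  moreover have "norm b * norm z < 1 * 1"
    using assms by (intro mult_strict_mono) auto
  ultimately show False
    by (simp add: norm_mult)
qed

lemma moebius_disk_aut:
  assumes "norm a < 1"
  shows "(\<lambda>z. (z - a) / (1 - cnj a * z)) \<in> disk_aut"
proof -
  have "bij_betw (Moebius_function 0 a) disk disk"
    by (rule bij_betw_byWitness[where f' = "Moebius_function 0 (- a)"])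
      (use assms Moebius_function_norm_lt_1[of a] Moebius_function_norm_lt_1[of "- a"] in
        \<open>auto simp: Moebius_function_compose\<close>)
  then show ?thesis
    using Moebius_function_holomorphic[OF assms, of 0]
    by (simp add: disk_aut_def Moebius_function_simple[abs_def])
qed

text \<open>Moving the zero \<open>a\<close> of \<open>\<phi>\<close> to the origin gives an
  automorphism \<open>g\<close> fixing 0. By the Schwarz lemma for \<open>g\<close> and its inverse
  \<open>h\<close>, \<open>g\<close> is a rotation.\<close>

lemma disk_aut_cases:
  assumes "\<phi> \<in> disk_aut"
  obtains u a where "norm u = 1" "norm a < 1"
    "\<And>z. z \<in> disk \<Longrightarrow> \<phi> z = u * ((z - a) / (1 - cnj a * z))"
proof -
  obtain \<psi> where \<psi>: "\<psi> \<in> disk_aut" "\<And>z. z \<in> disk \<Longrightarrow> \<psi> (\<phi> z) = z" "\<And>z. z \<in> disk \<Longrightarrow> \<phi> (\<psi> z) = z"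
    using disk_aut_inverse[OF assms] by blast
  define a where "a = \<psi> 0"
  have a: "norm a < 1" "\<phi> a = 0"
    using disk_aut_in_disk[OF \<psi>(1), of 0] \<psi>(3)[of 0] by (auto simp: a_def)
  define M where "M = Moebius_function 0 a"
  define M' where "M' = Moebius_function 0 (- a)"
  have M_lt: "norm (M z) < 1" "norm (M' z) < 1" if "norm z < 1" for z
    using that a Moebius_function_norm_lt_1 by (auto simp: M_def M'_def)
  have M_inv: "M (M' z) = z" "M' (M z) = z" if "norm z < 1" for z
    using that a Moebius_function_compose by (auto simp: M_def M'_def)
  have M_hol: "M holomorphic_on disk" "M' holomorphic_on disk"
    using a Moebius_function_holomorphic by (auto simp: M_def M'_def)
  have M0: "M a = 0" "M' 0 = a"
    by (auto simp: M_def M'_def Moebius_function_def)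
  have \<phi>_lt: "norm (\<phi> z) < 1" "norm (\<psi> z) < 1" if "norm z < 1" for z
    using that disk_aut_in_disk[OF assms, of z] disk_aut_in_disk[OF \<psi>(1), of z] by auto
  define g where "g = \<phi> \<circ> M'"
  define h where "h = M \<circ> \<psi>"
  have g: "g holomorphic_on disk" "g 0 = 0" "\<And>z. norm z < 1 \<Longrightarrow> norm (g z) < 1"
    unfolding g_def using M_lt \<phi>_lt a M0
    by (auto intro!: holomorphic_on_compose_gen[OF M_hol(2) disk_aut_holomorphic[OF assms]])
  have h: "h holomorphic_on disk" "h 0 = 0" "\<And>z. norm z < 1 \<Longrightarrow> norm (h z) < 1"
    unfolding h_def using M_lt \<phi>_lt a M0
    by (auto intro!: holomorphic_on_compose_gen[OF disk_aut_holomorphic[OF \<psi>(1)] M_hol(1)]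
        simp: a_def)
  have hg: "h (g z) = z" if "norm z < 1" for z
    using that \<psi>(2)[of "M' z"] M_lt M_inv by (simp add: g_def h_def)
  have half: "norm (1/2 :: complex) < 1" by simp
  \<comment> \<open>Schwarz for \<open>g\<close> at 1/2 and for \<open>h\<close> at
    \<open>g (1/2)\<close> gives the two inequalities; equality at one nonzero point is
    enough.\<close>
  have "norm (g (1/2)) = norm (1/2 :: complex)"
    using Schwarz_Lemma(1)[OF g half] Schwarz_Lemma(1)[OF h g(3)[OF half]] hg[OF half] by simp
  then have "\<exists>z. norm z < 1 \<and> z \<noteq> 0 \<and> norm (g z) = norm z"
    using half by (intro exI[of _ "1/2"]) simp
  then obtain u where u: "\<And>z. norm z < 1 \<Longrightarrow> g z = u * z" "norm u = 1"
    using Schwarz_Lemma(3)[OF g half] by blast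
  show thesis
  proof (rule that[OF u(2) a(1)])
    fix z :: complex assume z: "z \<in> disk"
    have "\<phi> z = g (M z)"
      using z M_inv by (simp add: g_def)
    also have "\<dots> = u * M z"
      using z M_lt u(1) by simp
    finally show "\<phi> z = u * ((z - a) / (1 - cnj a * z))"
      by (simp add: M_def Moebius_function_simple)
  qed
qed

section \<open>Pointwise multipliers and Taylor expansion of automorphisms\<close>

lemma mult_op_cong:
  assumes "\<And>z. z \<in> disk \<Longrightarrow> g z = h z"
  shows "mult_op g = mult_op h"
  using assms by (auto simp: mult_op_def fun_eq_iff)

lemma mult_op_mult_op:
  assumes "\<And>z. z \<in> disk \<Longrightarrow> g z * h z = 1" "\<And>z. z \<notin> disk \<Longrightarrow> f z = 0"
  shows "mult_op g (mult_op h f) = f"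
proof
  fix z
  show "mult_op g (mult_op h f) z = f z"
    using assms(1)[of z] assms(2)[of z]
    by (cases "z \<in> disk") (simp_all add: mult_op_def flip: mult.assoc)
qed

text \<open>Follows from \<open>(z - a) / (1 - cnj a * z) = - a + (1 - a * cnj a) * z / (1 - cnj a *
  z)\<close> and the geometric series.\<close>

lemma moebius_coef:
  assumes a: "norm a < 1"
  shows "coef (\<lambda>z. u * ((z - a) / (1 - cnj a * z))) k
       = (case k of 0 \<Rightarrow> - u * a | Suc j \<Rightarrow> u * (1 - a * cnj a) * cnj a ^ j)"
proof -
  define F where "F = Abs_fps (\<lambda>k. case k of 0 \<Rightarrow> - u * a | Suc j \<Rightarrow> u * (1 - a * cnj a) * cnj a ^ j)"
  have "(\<lambda>k. fps_nth F k * z ^ k) sums (u * ((z - a) / (1 - cnj a * z)))" if z: "z \<in> disk" for z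
  proof -
    have nz: "1 - cnj a * z \<noteq> 0"
      using moebius_denominator_nonzero[of "cnj a" z] a z by simp
    have "norm (cnj a * z) < 1"
      using a z mult_strict_mono[of "norm a" 1 "norm z" 1] by (simp add: norm_mult)
    then have "(\<lambda>j. u * (1 - a * cnj a) * z * (cnj a * z) ^ j) sums
        (u * (1 - a * cnj a) * z * (1 / (1 - cnj a * z)))"
      by (intro sums_mult geometric_sums)
    then have "(\<lambda>j. fps_nth F (Suc j) * z ^ Suc j) sums
        (u * (1 - a * cnj a) * z * (1 / (1 - cnj a * z)))"
      by (simp add: F_def power_mult_distrib mult_ac)
    from sums_Suc[OF this] have "(\<lambda>k. fps_nth F k * z ^ k) sums
        (u * (1 - a * cnj a) * z * (1 / (1 - cnj a * z)) - u * a)"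
      by (simp add: F_def)
    also have "u * (1 - a * cnj a) * z * (1 / (1 - cnj a * z)) - u * a
        = u * ((z - a) / (1 - cnj a * z))"
      using nz by (simp add: divide_simps) (simp add: algebra_simps)
    finally show ?thesis .
  qed
  then have "\<forall>\<^sub>F z in nhds 0. (\<lambda>k. fps_nth F k * z ^ k) sums (u * ((z - a) / (1 - cnj a * z)))"
    by (intro eventually_mono[OF eventually_nhds_in_open[of disk 0]]) auto
  from coef_eqI[OF has_fps_expansionI[OF this]] show ?thesis
    by (simp add: F_def)
qed

text \<open>The tail of a geometric series is explicit: a scalar decaying like
  \<open>cnj a ^ n\<close>, a power of \<open>z\<close>, and the fixed kernel
  \<open>1 / (1 - cnj a * z)\<close>. Each factor is a multiplier with a known bound.\<close>

lemma moebius_taylor_remainder: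
  assumes a: "norm a < 1" and z: "z \<in> disk"
  shows "(\<Sum>k<Suc n. coef (\<lambda>z. u * ((z - a) / (1 - cnj a * z))) k * z ^ k)
       = u * ((z - a) / (1 - cnj a * z)) - u * (1 - a * cnj a) * cnj a ^ n * (z ^ Suc n / (1 - cnj a * z))"
proof -
  have nz: "1 - cnj a * z \<noteq> 0"
    using moebius_denominator_nonzero[of "cnj a" z] a z by simp
  show ?thesis
  proof (induction n)
    case 0
    show ?case
      unfolding sum.lessThan_Suc moebius_coef[OF a]
      using nz by (simp add: divide_simps) (simp add: algebra_simps)
  next
    case (Suc n)
    let ?c = "u * (1 - a * cnj a)"
    have "cnj a ^ n * z ^ Suc n - cnj a ^ n * (z ^ Suc n / (1 - cnj a * z))
        = - (cnj a ^ Suc n * (z ^ Suc (Suc n) / (1 - cnj a * z)))"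
      using nz by (simp add: divide_simps) (simp add: algebra_simps)
    then have "?c * (cnj a ^ n * z ^ Suc n - cnj a ^ n * (z ^ Suc n / (1 - cnj a * z)))
        = ?c * - (cnj a ^ Suc n * (z ^ Suc (Suc n) / (1 - cnj a * z)))"
      by (rule arg_cong)
    then have step: "?c * cnj a ^ n * z ^ Suc n - ?c * cnj a ^ n * (z ^ Suc n / (1 - cnj a * z))
        = - (?c * cnj a ^ Suc n * (z ^ Suc (Suc n) / (1 - cnj a * z)))"
      by (simp only: right_diff_distrib mult.assoc mult_minus_right)
    have "p - q + r = p - t" if "r - q = - t" for p q r t :: complex
      using that by algebra
    from this[OF step] show ?case
      unfolding sum.lessThan_Suc[of _ "Suc n"] Suc.IH
      unfolding moebius_coef[OF a] nat.case .
  qed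
qed

section \<open>Composition operators of automorphisms and similarity\<close>

context growth_weights
begin

lemma comp_op_bounded:
  assumes "\<phi> \<in> disk_aut"
  shows "bounded_op H N (comp_op \<phi>)"
proof -
  obtain u a where ua: "norm u = 1" "norm a < 1"
    and \<phi>: "\<And>z. z \<in> disk \<Longrightarrow> \<phi> z = u * ((z - a) / (1 - cnj a * z))"
    using disk_aut_cases[OF assms] by blast
  define s where "s = norm a"
  \<comment> \<open>A unimodular direction with \<open>a = - s * v\<close>; for \<open>a = 0\<close>
    the direction is arbitrary and 1 is taken.\<close>
  define v where "v = (if a = 0 then 1 else - a / of_real s)"
  have v: "norm v = 1" "a = - (of_real s * v)"
    by (auto simp: v_def s_def norm_divide)
  have vv: "v * cnj v = 1"
    using v(1) by (simp add: complex_norm_square[symmetric])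
  have s: "0 \<le> s" "s < 1"
    using ua by (auto simp: s_def)
  let ?h = "\<lambda>z. (z + of_real s) / (1 + of_real s * z)"
  \<comment> \<open>Composition reverses order: the outer rotation by \<open>u * v\<close> acts on
    \<open>f\<close> first.\<close>
  have "bounded_op H N (\<lambda>f. comp_op (\<lambda>z. cnj v * z) (comp_op ?h (comp_op (\<lambda>z. (u * v) * z) f)))"
  proof -
    have 1: "bounded_op H N (comp_op (\<lambda>z. cnj v * z))"
      using v by (intro comp_op_rotation_bounded) simp
    have 2: "bounded_op H N (comp_op ?h)"
      by (rule comp_op_hyperbolic_bounded[OF s])
    have 3: "bounded_op H N (comp_op (\<lambda>z. (u * v) * z))"
      using ua v by (intro comp_op_rotation_bounded) (simp add: norm_mult)
    show ?thesis
      using bounded_op_compose[OF 1 bounded_op_compose[OF 2 3]] .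
  qed
  moreover have "(\<lambda>f. comp_op (\<lambda>z. cnj v * z) (comp_op ?h (comp_op (\<lambda>z. (u * v) * z) f))) = comp_op \<phi>"
  proof (intro ext)
    fix f z
    show "comp_op (\<lambda>z. cnj v * z) (comp_op ?h (comp_op (\<lambda>z. (u * v) * z) f)) z = comp_op \<phi> f z"
    proof (cases "z \<in> disk")
      case True
      then have y: "norm (cnj v * z) < 1"
        using v by (simp add: norm_mult)
      then have "norm (?h (cnj v * z)) < 1"
        using Moebius_function_norm_lt_1[of "- of_real s" "cnj v * z" 0] s
        by (simp add: Moebius_function_def)
      moreover have "(u * v) * ?h (cnj v * z) = \<phi> z"
      proof -
        have "v * (cnj v * z + of_real s) = z - a"
          using vv by (simp add: v(2) distrib_left mult.assoc[symmetric])
        moreover have "1 + of_real s * (cnj v * z) = 1 - cnj a * z"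
          by (simp add: v(2))
        ultimately show ?thesis
          using \<phi>[OF True] by (simp add: mult.assoc)
      qed
      ultimately show ?thesis
        using True y by (simp add: comp_op_def)
    qed (simp add: comp_op_def)
  qed
  ultimately show ?thesis by simp
qed

lemma comp_op_comp_op:
  assumes "f \<in> H" "\<psi> \<in> disk_aut" "\<And>z. z \<in> disk \<Longrightarrow> \<phi> (\<psi> z) = z"
  shows "comp_op \<psi> (comp_op \<phi> f) = f"
  using assms(3) disk_aut_in_disk[OF assms(2)] H_outside[OF assms(1)]
  by (auto simp: comp_op_def fun_eq_iff)

lemma comp_op_invertible:
  assumes "\<phi> \<in> disk_aut"
  shows "invertible_op H N (comp_op \<phi>)"
proof -
  obtain \<psi> where \<psi>: "\<psi> \<in> disk_aut" "\<And>z. z \<in> disk \<Longrightarrow> \<psi> (\<phi> z) = z" "\<And>z. z \<in> disk \<Longrightarrow> \<phi> (\<psi> z) = z"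
    using disk_aut_inverse[OF assms] by blast
  then show ?thesis
    unfolding invertible_op_def using assms
    by (intro conjI exI[of _ "comp_op \<psi>"] ballI comp_op_bounded comp_op_comp_op)
qed

lemma comp_op_mult_op:
  assumes "\<phi> \<in> disk_aut"
  shows "comp_op \<phi> (mult_op (\<lambda>z. z) f) = mult_op \<phi> (comp_op \<phi> f)"
  using disk_aut_in_disk[OF assms] by (auto simp: comp_op_def mult_op_def fun_eq_iff)

text \<open>Conjugating multiplication by \<open>z\<close> with the composition operator gives
  multiplication by \<open>\<phi>\<close>, so no separate multiplier estimate is made.\<close>

lemma mult_op_disk_aut_bounded:
  assumes "\<phi> \<in> disk_aut"
  shows "bounded_op H N (mult_op \<phi>)"
proof -
  obtain \<psi> where \<psi>: "\<psi> \<in> disk_aut" "\<And>z. z \<in> disk \<Longrightarrow> \<psi> (\<phi> z) = z" "\<And>z. z \<in> disk \<Longrightarrow> \<phi> (\<psi> z) = z"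
    using disk_aut_inverse[OF assms] by blast
  show ?thesis
  proof (rule bounded_op_cong)
    show "bounded_op H N (\<lambda>f. comp_op \<phi> (mult_op (\<lambda>z. z) (comp_op \<psi> f)))"
      using bounded_op_compose[OF comp_op_bounded[OF assms]
          bounded_op_compose[OF mult_op_id_bounded comp_op_bounded[OF \<psi>(1)]]] .
    show "comp_op \<phi> (mult_op (\<lambda>z. z) (comp_op \<psi> f)) = mult_op \<phi> f" if "f \<in> H" for f
      by (simp only: comp_op_mult_op[OF assms] comp_op_comp_op[OF that assms \<psi>(2)])
  qed
qed

lemma mult_op_z_similar:
  assumes "\<phi> \<in> disk_aut"
  shows "similar_ops H N (mult_op (\<lambda>z. z)) (mult_op \<phi>)"
  unfolding similar_ops_def
  using comp_op_invertible[OF assms] comp_op_mult_op[OF assms]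
    mult_op_id_bounded mult_op_disk_aut_bounded[OF assms] by blast

section \<open>Resolvent and functional calculus of multiplication by z\<close>

lemma mult_op_geometric_bounded:
  assumes "norm b < 1"
  shows "bounded_op H N (mult_op (\<lambda>z. 1 / (1 - b * z)))"
proof -
  define a where "a = cnj b"
  have a: "norm a < 1"
    using assms by (simp add: a_def)
  have d: "1 - a * b \<noteq> 0"
    using moebius_denominator_nonzero[of a b] a assms by simp
  \<comment> \<open>The coefficients come from \<open>b * (z - a) + (1 - b * z) = 1 - a * b\<close>,
    divided by both \<open>1 - a * b\<close> and \<open>1 - b * z\<close>.\<close>
  have "bounded_op H N (mult_op (\<lambda>z. b / (1 - a * b) * ((z - a) / (1 - cnj a * z)) + 1 / (1 - a * b)))"
    by (intro mult_op_affine_bounded mult_op_disk_aut_bounded moebius_disk_aut a)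
  also have "mult_op (\<lambda>z. b / (1 - a * b) * ((z - a) / (1 - cnj a * z)) + 1 / (1 - a * b))
      = mult_op (\<lambda>z. 1 / (1 - b * z))"
  proof (rule mult_op_cong)
    fix z assume "z \<in> disk"
    then have nz: "1 - b * z \<noteq> 0"
      using moebius_denominator_nonzero assms by blast
    have "b * (z - a) + (1 - b * z) = 1 - a * b"
      by (simp add: algebra_simps)
    moreover have "1 / (1 - b * z) = (1 - a * b) / ((1 - a * b) * (1 - b * z))"
      using d by simp
    ultimately have "1 / (1 - b * z) = (b * (z - a) + (1 - b * z)) / ((1 - a * b) * (1 - b * z))"
      by (simp only:)
    also have "\<dots> = b / (1 - a * b) * ((z - a) / (1 - b * z)) + 1 / (1 - a * b)"
      using nz by (simp add: add_divide_distrib)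
    finally show "b / (1 - a * b) * ((z - a) / (1 - cnj a * z)) + 1 / (1 - a * b) = 1 / (1 - b * z)"
      by (simp add: a_def)
  qed
  finally show ?thesis .
qed

lemma mult_op_z_spectrum: "op_spectrum H N (mult_op (\<lambda>z. z)) \<subseteq> cball 0 1"
proof
  fix c assume c: "c \<in> op_spectrum H N (mult_op (\<lambda>z. z))"
  show "c \<in> cball 0 1"
  proof (rule ccontr)
    assume "c \<notin> cball 0 1"
    then have c1: "1 < norm c" by simp
    then have c0: "c \<noteq> 0" by auto
    define b where "b = 1 / c"
    have b: "norm b < 1"
      using c1 by (auto simp: b_def norm_divide divide_less_eq)
    define T where "T f x = mult_op (\<lambda>z. z) f x - c * f x" for f x
    \<comment> \<open>With \<open>b = 1 / c\<close> the inverse of \<open>z - c\<close> is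
      \<open>- b / (1 - b * z)\<close>. Both \<open>g\<close> and \<open>h\<close> are spelled as
      affine expressions to fit \<open>mult_op_affine_bounded\<close>.\<close>
    define g where "g z = 1 * z + - c" for z
    define h where "h z = - b * (1 / (1 - b * z)) + 0" for z
    have T_eq: "mult_op g f = T f" if "f \<in> H" for f
    proof
      fix z
      show "mult_op g f z = T f z"
        using H_outside[OF that, of z]
        by (cases "z \<in> disk") (simp_all add: mult_op_def T_def g_def left_diff_distrib)
    qed
    have "bounded_op H N (mult_op g)"
      unfolding g_def by (rule mult_op_affine_bounded[OF mult_op_id_bounded])
    from bounded_op_cong[where S = "mult_op g" and T = T, OF T_eq this]
    have T: "bounded_op H N T" .
    have S: "bounded_op H N (mult_op h)"
      unfolding h_def by (rule mult_op_affine_bounded[OF mult_op_geometric_bounded[OF b]])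
    have gh: "g z * h z = 1" if "z \<in> disk" for z
    proof -
      have "g z * - b = 1 - b * z"
        using c0 by (simp add: b_def g_def field_simps)
      moreover have "g z * h z = (g z * - b) * (1 / (1 - b * z))"
        by (simp add: h_def)
      ultimately show ?thesis
        using moebius_denominator_nonzero[OF b that] by simp
    qed
    have "mult_op h (T f) = f" "T (mult_op h f) = f" if f: "f \<in> H" for f
    proof -
      have "mult_op h (mult_op g f) = f" "mult_op g (mult_op h f) = f"
        using gh H_outside[OF f] by (auto intro!: mult_op_mult_op simp: mult.commute)
      then show "mult_op h (T f) = f" "T (mult_op h f) = f"
        by (simp_all only: T_eq[OF f, symmetric] T_eq[OF bounded_op_mem[OF S f], symmetric])
    qed
    then have "invertible_op H N T"
      unfolding invertible_op_def using T S by blast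
    then show False
      using c by (simp add: op_spectrum_def T_def[abs_def])
  qed
qed

lemma mult_op_z_funpow:
  assumes "f \<in> H"
  shows "(mult_op (\<lambda>z. z) ^^ k) f = mult_op (\<lambda>z. z ^ k) f"
proof (induction k)
  case 0
  then show ?case
    \<comment> \<open>Multiplication by 1 is the identity only on functions that vanish outside the
      disk.\<close>
    using H_outside[OF assms] by (auto simp: mult_op_def fun_eq_iff)
next
  case (Suc k)
  then show ?case
    by (auto simp: mult_op_def fun_eq_iff)
qed

lemma mult_op_fun_calc:
  assumes "\<phi> \<in> disk_aut"
  shows "is_fun_calc H N (mult_op (\<lambda>z. z)) \<phi> (mult_op \<phi>)"
proof -
  obtain u a where ua: "norm u = 1" "norm a < 1"
    and \<phi>: "\<And>z. z \<in> disk \<Longrightarrow> \<phi> z = u * ((z - a) / (1 - cnj a * z))"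
    using disk_aut_cases[OF assms] by blast
  define Q where "Q = mult_op (\<lambda>z. 1 / (1 - cnj a * z))"
  have Q: "bounded_op H N Q"
    unfolding Q_def using ua by (intro mult_op_geometric_bounded) simp
  obtain C where C: "0 \<le> C" "\<And>f. f \<in> H \<Longrightarrow> N (Q f) \<le> C * N f"
    using bounded_opE[OF Q] by blast
  \<comment> \<open>Greater than 1, as the bound on powers of \<open>z\<close> requires, yet small
    enough that \<open>\<rho> * norm a < 1\<close>, so the remainders decay geometrically.\<close>
  define \<rho> where "\<rho> = 2 / (1 + norm a)"
  have "0 < 1 + norm a"
    by (rule add_pos_nonneg) auto
  then have \<rho>: "1 < \<rho>" "\<rho> * norm a < 1"
    using ua by (auto simp: \<rho>_def field_simps)
  obtain B where B: "0 \<le> B"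
    "\<And>f n. f \<in> H \<Longrightarrow> mult_op (\<lambda>z. z ^ n) f \<in> H \<and> N (mult_op (\<lambda>z. z ^ n) f) \<le> B * \<rho> ^ n * N f"
    using mult_op_power_bound[OF \<rho>(1)] by blast
  define d where "d n = - (u * (1 - a * cnj a) * cnj a ^ n)" for n
  define R where "R n = norm (1 - a * cnj a) * B * C * \<rho> * (\<rho> * norm a) ^ n" for n
  have R_lim: "R \<longlonglongrightarrow> 0"
  proof -
    have "(\<lambda>n. norm (1 - a * cnj a) * B * C * \<rho> * (\<rho> * norm a) ^ n)
        \<longlonglongrightarrow> norm (1 - a * cnj a) * B * C * \<rho> * 0"
      using \<rho> by (intro tendsto_mult tendsto_const LIMSEQ_power_zero) simp
    then show ?thesis
      by (simp add: R_def[abs_def])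
  qed
  have coef_\<phi>: "coef \<phi> k = coef (\<lambda>z. u * ((z - a) / (1 - cnj a * z))) k" for k
    by (rule coef_cong[OF \<phi>])
  let ?E = "\<lambda>n f x. (\<Sum>k<n. coef \<phi> k * (mult_op (\<lambda>z. z) ^^ k) f x) - mult_op \<phi> f x"
  have remainder: "?E (Suc n) f = (\<lambda>x. d n * mult_op (\<lambda>z. z ^ Suc n) (Q f) x)" if f: "f \<in> H" for n f
  proof
    fix z
    show "?E (Suc n) f z = d n * mult_op (\<lambda>z. z ^ Suc n) (Q f) z"
    proof (cases "z \<in> disk")
      case True
      have "?E (Suc n) f z = ((\<Sum>k<Suc n. coef \<phi> k * z ^ k) - \<phi> z) * f z"
        unfolding mult_op_z_funpow[OF f] left_diff_distrib sum_distrib_right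
        using True by (simp add: mult_op_def mult.assoc)
      also have "(\<Sum>k<Suc n. coef \<phi> k * z ^ k) - \<phi> z = d n * (z ^ Suc n / (1 - cnj a * z))"
        unfolding coef_\<phi> moebius_taylor_remainder[OF ua(2) True] \<phi>[OF True] d_def by simp
      also have "\<dots> * f z = d n * mult_op (\<lambda>z. z ^ Suc n) (Q f) z"
        using True by (simp add: mult_op_def Q_def)
      finally show ?thesis .
    next
      case False
      then show ?thesis
        unfolding mult_op_z_funpow[OF f] by (simp add: mult_op_def)
    qed
  qed
  have bound: "N (?E (Suc n) f) \<le> R n * N f" if f: "f \<in> H" for n f
  proof -
    note Qf = bounded_op_mem[OF Q f]
    have "N (?E (Suc n) f) \<le> norm (d n) * N (mult_op (\<lambda>z. z ^ Suc n) (Q f))"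
      unfolding remainder[OF f] using B(2)[OF Qf] by (intro H_cmult) blast
    also have "\<dots> \<le> norm (d n) * (B * \<rho> ^ Suc n * (C * N f))"
    proof (intro mult_left_mono)
      have "N (mult_op (\<lambda>z. z ^ Suc n) (Q f)) \<le> B * \<rho> ^ Suc n * N (Q f)"
        using B(2)[OF Qf] by blast
      also have "\<dots> \<le> B * \<rho> ^ Suc n * (C * N f)"
        using B(1) \<rho>(1) by (intro mult_left_mono C(2) f) simp
      finally show "N (mult_op (\<lambda>z. z ^ Suc n) (Q f)) \<le> B * \<rho> ^ Suc n * (C * N f)" .
    qed simp
    also have "\<dots> = R n * N f"
      using ua by (simp add: d_def R_def norm_mult norm_power power_mult_distrib)
    finally show ?thesis .
  qed
  have "\<forall>\<^sub>F n in sequentially. \<forall>f\<in>H. N (?E n f) \<le> e * N f" if "0 < e" for e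
  proof -
    have "\<forall>\<^sub>F n in sequentially. R n < e"
      using order_tendstoD(2)[OF R_lim that] .
    then have "\<forall>\<^sub>F n in sequentially. \<forall>f\<in>H. N (?E (Suc n) f) \<le> e * N f"
    proof eventually_elim
      case (elim n)
      show ?case
      proof
        fix f assume f: "f \<in> H"
        have "R n * N f \<le> e * N f"
          using elim f by (intro mult_right_mono) auto
        with bound[OF f, of n] show "N (?E (Suc n) f) \<le> e * N f"
          by (rule order_trans)
      qed
    qed
    then show ?thesis
      \<comment> \<open>The remainder formula starts with one Taylor term; an index shift does not
        affect an eventual statement.\<close>
      by (subst (asm) eventually_sequentially_Suc)
  qed
  then show ?thesis
    unfolding is_fun_calc_def using mult_op_disk_aut_bounded[OF assms] by blast
qed

lemma mult_op_z_weakly_homogeneous: "weakly_homogeneous H N (mult_op (\<lambda>z. z))"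
  unfolding weakly_homogeneous_def
  using mult_op_id_bounded mult_op_z_spectrum mult_op_fun_calc mult_op_z_similar by blast

end

theorem theorem2p1:
  fixes w :: "nat \<Rightarrow> real"
  assumes "weight_seq w" and "polynomial_growth w"
  shows "(\<forall>\<phi>\<in>disk_aut.
            similar_ops (hardy_space w) (hardy_norm w) (mult_op (\<lambda>z. z)) (mult_op \<phi>)) \<and>
         weakly_homogeneous (hardy_space w) (hardy_norm w) (mult_op (\<lambda>z. z)) \<and>
         (\<forall>\<phi>\<in>disk_aut. invertible_op (hardy_space w) (hardy_norm w) (comp_op \<phi>))"
proof -
  interpret growth_weights w
    by unfold_locales (fact assms)+
  show ?thesis
    using mult_op_z_similar mult_op_z_weakly_homogeneous comp_op_invertible by blast
qed

end
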